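(* Suppose that $1<p<\infty$, let $p'$ be defined by $\frac1p+\frac1{p'}=1$, and let $\mu$ be a positive Borel measure on $[0,1)$. Let $\nu$ be the measure on $[0,1)$ defined by $d\nu(t)=\left(\log\frac{2}{1-t}\right)^{1/p'}\,d\mu(t)$. (i) If $\nu$ is a Carleson measure, then the operator $I_\mu$ is bounded from $B^p$ into $BMOA$. (ii) If $\nu$ is a vanishing Carleson measure, then the operator $I_\mu$ is compact from $B^p$ into $BMOA$.
   Context: $\mathbb D=\{z\in\mathbb C:|z|<1\}$, and $dA(z)=\frac{dx\,dy}{\pi}$. For $1<p<\infty$ the analytic Besov space $B^p$ is the set of analytic functions $f$ in $\mathbb D$ with $\|f\|_{B^p}=\left(|f(0)|^p+\rho_p(f)^p\right)^{1/p}<\infty$, where $\rho_p(f)=\left(\int_{\mathbb D}(1-|z|^2)^{p-2}|f'(z)|^p\,dA(z)\right)^{1/p}$. For $a\in\mathbb D$ let $\varphi_a(z)=\frac{a-z}{1-\overline a z}$; $BMOA$ is the set of analytic functions $f$ in $\mathbb D$ with $\|f\|_{BMOA}=|f(0)|+\sup_{a\in\mathbb D}\|f\circ\varphi_a-f(a)\|_{H^2}<\infty$, where $H^2$ is the Hardy space. The operator $I_\mu$ is given by $I_\mu(f)(z)=\int_{[0,1)}\frac{f(t)}{1-tz}\,d\mu(t)$, $z\in\mathbb D$, whenever the right-hand side makes sense and defines an analytic function in $\mathbb D$; boundedness or compactness on a space includes that it is well defined for every $f$ in the space. A positive Borel measure $\nu$ on $[0,1)$ is a Carleson measure if there is $C>0$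 with $\nu([t,1))\le C(1-t)$ for all $0\le t<1$; it is a vanishing Carleson measure if, in addition, $\lim_{t\to1^-}\frac{\nu([t,1))}{1-t}=0$. *)

theory Defs
  imports "HOL-Complex_Analysis.Complex_Analysis"
begin

text \<open>
  A function on the unit disc is represented by a total function of type
  \<open>complex \<Rightarrow> complex\<close>; none of the notions below depends on its values outside the disc.
\<close>

abbreviation unit_disc :: "complex set" where
  "unit_disc \<equiv> ball 0 1"

definition area_measure :: "complex measure" where
  "area_measure = density lborel (\<lambda>_. ennreal (1 / pi))"

subsection \<open>Analytic Besov spaces\<close>

text \<open>The \<open>p\<close>-th power of the Besov seminorm, as an extended number.\<close>

definition Besov_energy :: "real \<Rightarrow> (complex \<Rightarrow> complex) \<Rightarrow> ennreal" where
  "Besov_energy p f =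
     (\<integral>\<^sup>+z\<in>unit_disc. ennreal ((1 - (norm z)\<^sup>2) powr (p - 2) * norm (deriv f z) powr p) \<partial>area_measure)"

definition Besov :: "real \<Rightarrow> (complex \<Rightarrow> complex) set" where
  "Besov p = {f. f holomorphic_on unit_disc \<and> Besov_energy p f < \<infinity>}"

definition Besov_seminorm :: "real \<Rightarrow> (complex \<Rightarrow> complex) \<Rightarrow> real" where
  "Besov_seminorm p f = enn2real (Besov_energy p f) powr (1 / p)"

definition Besov_norm :: "real \<Rightarrow> (complex \<Rightarrow> complex) \<Rightarrow> real" where
  "Besov_norm p f = (norm (f 0) powr p + Besov_seminorm p f powr p) powr (1 / p)"

subsection \<open>The space BMOA\<close>

text \<open>The norm of the Hardy space \<open>H\<^sup>2\<close>; it is infinite for analytic functions outside \<open>H\<^sup>2\<close>.\<close>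

definition H2_enorm :: "(complex \<Rightarrow> complex) \<Rightarrow> ennreal" where
  "H2_enorm f =
     (SUP r\<in>{0<..<1::real}.
        ennreal (sqrt (1 / (2 * pi) * (LBINT t:{0..2 * pi}. (norm (f (of_real r * cis t)))\<^sup>2))))"

definition disc_aut :: "complex \<Rightarrow> complex \<Rightarrow> complex" where
  "disc_aut a z = (a - z) / (1 - cnj a * z)"

definition BMOA_enorm :: "(complex \<Rightarrow> complex) \<Rightarrow> ennreal" where
  "BMOA_enorm f =
     ennreal (norm (f 0)) + (SUP a\<in>unit_disc. H2_enorm (\<lambda>z. f (disc_aut a z) - f a))"

definition BMOA :: "(complex \<Rightarrow> complex) set" where
  "BMOA = {f. f holomorphic_on unit_disc \<and> BMOA_enorm f < \<infinity>}"

definition BMOA_norm :: "(complex \<Rightarrow> complex) \<Rightarrow> real" where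
  "BMOA_norm f = enn2real (BMOA_enorm f)"

subsection \<open>Carleson measures on \<open>[0,1)\<close>\<close>

definition Borel_measure_on_01 :: "real measure \<Rightarrow> bool" where
  "Borel_measure_on_01 \<mu> \<longleftrightarrow> sets \<mu> = sets (restrict_space borel {0..<1})"

definition Carleson :: "real measure \<Rightarrow> bool" where
  "Carleson \<nu> \<longleftrightarrow> Borel_measure_on_01 \<nu> \<and>
     (\<exists>C>0. \<forall>t\<in>{0..<1}. emeasure \<nu> {t..<1} \<le> ennreal (C * (1 - t)))"

definition vanishing_Carleson :: "real measure \<Rightarrow> bool" where
  "vanishing_Carleson \<nu> \<longleftrightarrow> Carleson \<nu> \<and>
     ((\<lambda>t. measure \<nu> {t..<1} / (1 - t)) \<longlongrightarrow> 0) (at_left 1)"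

subsection \<open>The operator \<open>I\<^sub>\<mu>\<close>\<close>

definition I_op :: "real measure \<Rightarrow> (complex \<Rightarrow> complex) \<Rightarrow> complex \<Rightarrow> complex" where
  "I_op \<mu> f z = (\<integral>t. f (of_real t) / (1 - of_real t * z) \<partial>\<mu>)"

text \<open>
  The Bochner integral is \<open>0\<close> for non-integrable functions, so integrability has to be
  required separately.
\<close>

definition I_op_defined :: "real measure \<Rightarrow> (complex \<Rightarrow> complex) \<Rightarrow> bool" where
  "I_op_defined \<mu> f \<longleftrightarrow>
     (\<forall>z\<in>unit_disc. integrable \<mu> (\<lambda>t. f (of_real t) / (1 - of_real t * z))) \<and>
     I_op \<mu> f holomorphic_on unit_disc"

definition I_op_bounded :: "real measure \<Rightarrow> real \<Rightarrow> bool" where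
  "I_op_bounded \<mu> p \<longleftrightarrow>
     (\<forall>f\<in>Besov p. I_op_defined \<mu> f \<and> I_op \<mu> f \<in> BMOA) \<and>
     (\<exists>C. \<forall>f\<in>Besov p. BMOA_norm (I_op \<mu> f) \<le> C * Besov_norm p f)"

text \<open>
  Compactness: the image of every norm-bounded sequence in the Besov space has a subsequence
  that converges, in norm, to an element of BMOA.
\<close>

definition I_op_compact :: "real measure \<Rightarrow> real \<Rightarrow> bool" where
  "I_op_compact \<mu> p \<longleftrightarrow>
     (\<forall>f\<in>Besov p. I_op_defined \<mu> f \<and> I_op \<mu> f \<in> BMOA) \<and>
     (\<forall>F. range F \<subseteq> Besov p \<and> bdd_above (range (\<lambda>n. Besov_norm p (F n))) \<longrightarrow>
        (\<exists>g\<in>BMOA. \<exists>r :: nat \<Rightarrow> nat. strict_mono r \<and>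
           (\<lambda>k. BMOA_norm (\<lambda>z. I_op \<mu> (F (r k)) z - g z)) \<longlonglongrightarrow> 0))"

end

theory Submission
  imports Defs
begin

text \<open>
  A function \<open>f\<close> of the Besov space is known to the operator only through its values on the radius
  \<open>[0,1)\<close>, and there \<open>\<bar>f t\<bar> \<le> D \<parallel>f\<parallel> L t\<close> with \<open>L t = ln (2/(1-t)) powr (1/p')\<close>
  (lemma \<open>Besov_radial_growth\<close>). Hence \<open>\<bar>f\<bar> d\<mu> \<le> D \<parallel>f\<parallel> d\<nu>\<close>, and everything reduces to one estimate
  for Cauchy transforms: if the measure \<open>\<bar>k\<bar> d\<mu>\<close> is Carleson with constant \<open>K\<close>, then
  \<open>G z = \<integral> k t / (1 - t z) d\<mu> t\<close> lies in BMOA with norm at most \<open>145 K\<close>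
  (lemma \<open>BMOA_enorm_Cauchy_transform\<close>).

  The BMOA estimate is direct, without duality. Since \<open>\<bar>1 - t z\<bar>\<close> is comparable to
  \<open>(1 - t) + \<bar>1 - z\<bar>\<close>, the Carleson condition gives
  \<open>\<bar>G z - G a\<bar> \<le> 72 K (\<bar>1-a\<bar> / \<bar>1-z\<bar>) powr (1/4)\<close> if \<open>\<bar>1-z\<bar> \<le> \<bar>1-a\<bar>\<close>, and symmetrically
  in the other case; so \<open>G\<close> oscillates like a small power at most. For \<open>z = \<phi>\<^sub>a u\<close> the quotient
  \<open>\<bar>1-z\<bar> / \<bar>1-a\<bar>\<close> equals \<open>\<bar>1 - b u\<bar> / \<bar>1 - cnj a u\<bar>\<close> with \<open>\<bar>b\<bar> = 1\<close>. The Hardy norm of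
  \<open>G \<circ> \<phi>\<^sub>a - G a\<close> is therefore controlled by circle means of \<open>\<bar>1 - c u\<bar>\<close> to the power \<open>-1/2\<close> with
  \<open>\<bar>c\<bar> \<le> 1\<close>. As \<open>1 - c u\<close> has positive real part, this is at most \<open>sqrt 2\<close> times the real part of the
  holomorphic function \<open>(1 - c u) powr (-1/2)\<close>, whose mean is its value \<open>1\<close> at the centre: the
  bound does not depend on \<open>a\<close>.

  The growth bound follows from writing \<open>f t - f 0\<close> as the integral of \<open>f'\<close> over \<open>[0,t]\<close> and applying
  Hoelder's inequality with the weight \<open>(1-s)\<close> to the power \<open>p-1\<close>. That the weighted integral of
  \<open>\<bar>f'\<bar>\<close> to the power \<open>p\<close> along the radius is dominated by the Besov energy
  (lemma \<open>radial_Carleson_embedding\<close>) is the sub-mean value property over the discs of radius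
  \<open>(1-s)/2\<close> about \<open>s\<close>, followed by Tonelli's theorem.

  For compactness, a bounded sequence in the Besov space has, by Montel's theorem, a subsequence
  that converges locally uniformly to some \<open>f\<close>, and \<open>f\<close> inherits the radial growth bound. Let \<open>k\<^sub>n\<close> be the
  difference on the radius. On \<open>[0,\<tau>]\<close> it is uniformly small, and near \<open>1\<close> the vanishing Carleson
  condition makes the measure \<open>\<bar>k\<^sub>n\<bar> d\<mu>\<close> small, so the Carleson constants of \<open>\<bar>k\<^sub>n\<bar> d\<mu>\<close> tend to \<open>0\<close>
  (lemma \<open>Carleson_bound_split\<close>), and the BMOA estimate concludes.
\<close>

section \<open>Rotation invariance of the area\<close>

lemma nn_integral_lborel_translate:
  fixes u :: "'a::euclidean_space \<Rightarrow> ennreal"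
  assumes [measurable]: "u \<in> borel_measurable borel"
  shows "(\<integral>\<^sup>+x. u (c + x) \<partial>lborel) = (\<integral>\<^sup>+x. u x \<partial>lborel)"
proof -
  have "(\<integral>\<^sup>+x. u x \<partial>lborel) = (\<integral>\<^sup>+x. u x \<partial>distr lborel borel ((+) c))"
    by (simp add: lborel_distr_plus)
  also have "\<dots> = (\<integral>\<^sup>+x. u (c + x) \<partial>lborel)"
    by (subst nn_integral_distr) auto
  finally show ?thesis by simp
qed

text \<open>
  The image of the area under a rotation is again translation invariant, and translation invariant
  measures are unique up to a factor; here the uniqueness argument is carried out for integrals.
  Convolving \<open>u\<close> with the indicator \<open>B\<close> of the unit disc and exchanging the order of integration
  gives both sides times the area \<open>V\<close> of the disc, because \<open>B\<close> itself is rotation invariant. This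
  makes rotations available without polar coordinates.
\<close>

lemma nn_integral_lborel_rotate:
  fixes u :: "complex \<Rightarrow> ennreal"
  assumes u[measurable]: "u \<in> borel_measurable borel" and c: "norm c = 1"
  shows "(\<integral>\<^sup>+x. u (c * x) \<partial>lborel) = (\<integral>\<^sup>+x. u x \<partial>lborel)"
proof -
  define B :: "complex \<Rightarrow> ennreal" where "B = indicator (ball 0 1)"
  define V where "V = (\<integral>\<^sup>+x. B x \<partial>lborel)"
  have [measurable]: "B \<in> borel_measurable borel" unfolding B_def by (intro borel_measurable_indicator) auto
  have c0: "c \<noteq> 0" using c by auto
  have "V = emeasure lborel (ball (0::complex) 1)"
    by (simp add: V_def B_def)
  hence V: "V \<noteq> 0" "V \<noteq> \<infinity>"
    using content_ball_pos[of 1 "0::complex"] emeasure_lborel_ball_finite[of "0::complex" 1]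
    by (auto simp: measure_def)
  have "(\<integral>\<^sup>+x. u (c * x) \<partial>lborel) * V = (\<integral>\<^sup>+y. (\<integral>\<^sup>+x. u (c * x) \<partial>lborel) * B y \<partial>lborel)"
    unfolding V_def by (rule nn_integral_cmult[symmetric]) auto
  also have "\<dots> = (\<integral>\<^sup>+y. (\<integral>\<^sup>+x. u (c * x + y) * B y \<partial>lborel) \<partial>lborel)"
  proof (rule nn_integral_cong)
    fix y
    have "(\<integral>\<^sup>+x. u (c * x) \<partial>lborel) = (\<integral>\<^sup>+x. u (c * (y / c + x)) \<partial>lborel)"
      by (rule nn_integral_lborel_translate[symmetric]) measurable
    also have "\<dots> = (\<integral>\<^sup>+x. u (c * x + y) \<partial>lborel)"
      using c0 by (simp add: algebra_simps)
    finally show "(\<integral>\<^sup>+x. u (c * x) \<partial>lborel) * B y = (\<integral>\<^sup>+x. u (c * x + y) * B y \<partial>lborel)"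
      by (simp add: nn_integral_multc)
  qed
  also have "\<dots> = (\<integral>\<^sup>+x. (\<integral>\<^sup>+y. u (c * x + y) * B y \<partial>lborel) \<partial>lborel)"
    by (rule lborel_pair.Fubini') measurable
  also have "\<dots> = (\<integral>\<^sup>+x. (\<integral>\<^sup>+y. u y * B (x - y / c) \<partial>lborel) \<partial>lborel)"
  proof (rule nn_integral_cong)
    fix x
    have "(\<integral>\<^sup>+y. u (c * x + y) * B y \<partial>lborel) = (\<integral>\<^sup>+y. u (c * x + y) * B (x - (c * x + y) / c) \<partial>lborel)"
    proof (rule nn_integral_cong)
      fix y
      have "norm (x - (c * x + y) / c) = norm y"
        using c c0 by (simp add: add_divide_distrib norm_divide)
      thus "u (c * x + y) * B y = u (c * x + y) * B (x - (c * x + y) / c)"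
        by (simp add: B_def indicator_def)
    qed
    also have "\<dots> = (\<integral>\<^sup>+y. u y * B (x - y / c) \<partial>lborel)"
      by (rule nn_integral_lborel_translate[of "\<lambda>y. u y * B (x - y / c)"]) measurable
    finally show "(\<integral>\<^sup>+y. u (c * x + y) * B y \<partial>lborel) = (\<integral>\<^sup>+y. u y * B (x - y / c) \<partial>lborel)" .
  qed
  also have "\<dots> = (\<integral>\<^sup>+y. (\<integral>\<^sup>+x. u y * B (x - y / c) \<partial>lborel) \<partial>lborel)"
    by (rule lborel_pair.Fubini'[symmetric]) measurable
  also have "\<dots> = (\<integral>\<^sup>+y. u y * V \<partial>lborel)"
  proof (rule nn_integral_cong)
    fix y
    have "(\<integral>\<^sup>+x. B (x - y / c) \<partial>lborel) = V"
      using nn_integral_lborel_translate[of B "- (y / c)"] by (simp add: V_def)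
    thus "(\<integral>\<^sup>+x. u y * B (x - y / c) \<partial>lborel) = u y * V"
      by (subst nn_integral_cmult) auto
  qed
  also have "\<dots> = (\<integral>\<^sup>+y. u y \<partial>lborel) * V"
    by (rule nn_integral_multc) auto
  finally show ?thesis using V
    by (metis ennreal_mult_cancel_left infinity_ennreal_def mult.commute)
qed

lemma ennreal_eq_nn_integral_levels:
  assumes u: "(u::real) \<ge> 0"
  shows "ennreal u = (\<integral>\<^sup>+s. indicator {s. 0 \<le> s \<and> s < u} s \<partial>lborel)"
proof -
  have "{s. 0 \<le> s \<and> s < u} = {0..<u}" by auto
  thus ?thesis using u by (simp add: )
qed

section \<open>Carleson measures against increasing functions\<close>

lemma space_Borel_measure_on_01:
  "Borel_measure_on_01 \<mu> \<Longrightarrow> space \<mu> = {0..<1}"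
  unfolding Borel_measure_on_01_def by (drule sets_eq_imp_space_eq) (simp add: space_restrict_space)

lemma sets_Borel_measure_on_01:
  "Borel_measure_on_01 \<mu> \<Longrightarrow> A \<in> sets borel \<Longrightarrow> A \<subseteq> {0..<1} \<Longrightarrow> A \<in> sets \<mu>"
  unfolding Borel_measure_on_01_def by (auto simp: sets_restrict_space_iff)

lemma measurable_Borel_measure_on_01:
  assumes "Borel_measure_on_01 \<mu>" "F \<in> borel \<rightarrow>\<^sub>M N"
  shows "F \<in> \<mu> \<rightarrow>\<^sub>M N"
proof -
  have "F \<in> restrict_space borel {0..<1} \<rightarrow>\<^sub>M N"
    using assms(2) by (rule measurable_restrict_space1)
  thus ?thesis using assms(1) by (simp add: Borel_measure_on_01_def cong: measurable_cong_sets)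
qed

definition Carleson_bound :: "real \<Rightarrow> real measure \<Rightarrow> bool" where
  "Carleson_bound K \<nu> \<longleftrightarrow> (\<forall>t\<in>{0..<1}. emeasure \<nu> {t..<1} \<le> ennreal (K * (1 - t)))"

lemma finite_measure_Carleson_bound:
  assumes "Borel_measure_on_01 \<nu>" "Carleson_bound K \<nu>"
  shows "finite_measure \<nu>"
proof (rule finite_measureI)
  have "emeasure \<nu> {0..<1} \<le> ennreal (K * (1 - 0))"
    using assms(2) unfolding Carleson_bound_def by (rule bspec) simp
  also have "\<dots> < \<infinity>" by simp
  finally show "emeasure \<nu> (space \<nu>) \<noteq> \<infinity>"
    unfolding space_Borel_measure_on_01[OF assms(1)] by simp
qed

text \<open>
  The superlevel sets of an increasing function on \<open>[0,1)\<close> are intervals ending at \<open>1\<close>, on which a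
  Carleson measure is dominated by \<open>K\<close> times the length. The layer cake formula turns this into a
  comparison of integrals.
\<close>

lemma nn_integral_mono_Carleson:
  fixes F :: "real \<Rightarrow> real" and \<kappa> :: "real measure"
  assumes \<kappa>: "Borel_measure_on_01 \<kappa>" and car: "Carleson_bound K \<kappa>" and K: "K \<ge> 0"
    and F: "F \<in> borel_measurable borel"
    and mono: "mono_on {0..<1} F" and F0: "\<And>t. t \<in> {0..<1} \<Longrightarrow> 0 \<le> F t"
  shows "(\<integral>\<^sup>+t. F t \<partial>\<kappa>) \<le> ennreal K * (\<integral>\<^sup>+t\<in>{0..<1}. F t \<partial>lborel)"
proof -
  interpret finite_measure \<kappa> by (rule finite_measure_Carleson_bound) fact+
  interpret P: pair_sigma_finite \<kappa> lborel
    by (intro pair_sigma_finite.intro sigma_finite_measure_axioms sigma_finite_lborel)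
  note sp = space_Borel_measure_on_01[OF \<kappa>]
  note F[measurable] measurable_Borel_measure_on_01[OF \<kappa> F, measurable]
  define S where "S s = {t. t \<in> {0..<1} \<and> 0 \<le> s \<and> s < F t}" for s :: real
  have level: "(\<integral>\<^sup>+t. indicator {s. 0 \<le> s \<and> s < F t} s \<partial>\<kappa>) \<le>
      ennreal K * (\<integral>\<^sup>+t. indicator (S s) t \<partial>lborel)" for s
  proof (cases "S s = {}")
    case True
    have "(\<integral>\<^sup>+t. indicator {s. 0 \<le> s \<and> s < F t} s \<partial>\<kappa>) = (\<integral>\<^sup>+t. 0 \<partial>\<kappa>)"
      using True by (intro nn_integral_cong) (auto simp: sp S_def indicator_def)
    thus ?thesis by simp
  next
    case False
    define \<tau> where "\<tau> = Inf (S s)"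
    have bdd: "bdd_below (S s)" by (auto simp: S_def intro!: bdd_belowI[of _ 0])
    have \<tau>: "\<tau> \<in> {0..<1}"
    proof -
      obtain t where t: "t \<in> S s" using False by auto
      have "\<tau> \<le> t" unfolding \<tau>_def using bdd t by (rule cInf_lower[rotated])
      moreover have "0 \<le> \<tau>" unfolding \<tau>_def using False by (rule cInf_greatest) (auto simp: S_def)
      ultimately show ?thesis using t by (auto simp: S_def)
    qed
    have sub: "S s \<subseteq> {\<tau>..<1}"
      using cInf_lower[OF _ bdd] by (auto simp: S_def \<tau>_def)
    \<comment> \<open>Whether the endpoint \<open>\<tau>\<close> belongs to the level set is unknown, but it has no length.\<close>
    have sup: "{\<tau><..<1} \<subseteq> S s"
    proof
      fix x assume x: "x \<in> {\<tau><..<1}"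
      then obtain t where t: "t \<in> S s" "t < x"
        using cInf_lessD[OF False] unfolding \<tau>_def by auto
      have "F t \<le> F x" using mono t x \<tau> by (intro mono_onD[OF mono]) (auto simp: S_def)
      thus "x \<in> S s" using t x \<tau> by (auto simp: S_def)
    qed
    have "(\<integral>\<^sup>+t. indicator {s. 0 \<le> s \<and> s < F t} s \<partial>\<kappa>) \<le> (\<integral>\<^sup>+t. indicator {\<tau>..<1} t \<partial>\<kappa>)"
      using sub by (intro nn_integral_mono) (auto simp: sp S_def indicator_def)
    also have "\<dots> = emeasure \<kappa> {\<tau>..<1}" using \<tau> sets_Borel_measure_on_01[OF \<kappa>, of "{\<tau>..<1}"] by auto
    also have "\<dots> \<le> ennreal (K * (1 - \<tau>))" using car \<tau> unfolding Carleson_bound_def by blast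
    also have "\<dots> = ennreal K * emeasure lborel {\<tau><..<1}"
      using K \<tau> by (simp add: ennreal_mult)
    also have "\<dots> = ennreal K * (\<integral>\<^sup>+t. indicator {\<tau><..<1} t \<partial>lborel)" by simp
    also have "\<dots> \<le> ennreal K * (\<integral>\<^sup>+t. indicator (S s) t \<partial>lborel)"
      using sup by (intro mult_left_mono nn_integral_mono) (auto simp: indicator_def)
    finally show ?thesis .
  qed
  have "(\<integral>\<^sup>+t. F t \<partial>\<kappa>) = (\<integral>\<^sup>+t. (\<integral>\<^sup>+s. indicator {s. 0 \<le> s \<and> s < F t} s \<partial>lborel) \<partial>\<kappa>)"
    using F0 by (intro nn_integral_cong ennreal_eq_nn_integral_levels) (auto simp: sp)
  also have "\<dots> = (\<integral>\<^sup>+s. (\<integral>\<^sup>+t. indicator {s. 0 \<le> s \<and> s < F t} s \<partial>\<kappa>) \<partial>lborel)"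
    by (rule P.Fubini'[symmetric]) measurable
  also have "\<dots> \<le> (\<integral>\<^sup>+s. ennreal K * (\<integral>\<^sup>+t. indicator (S s) t \<partial>lborel) \<partial>lborel)"
    by (intro nn_integral_mono level)
  also have "\<dots> = ennreal K * (\<integral>\<^sup>+s. (\<integral>\<^sup>+t. indicator (S s) t \<partial>lborel) \<partial>lborel)"
    unfolding S_def by (rule nn_integral_cmult) measurable
  also have "(\<integral>\<^sup>+s. (\<integral>\<^sup>+t. indicator (S s) t \<partial>lborel) \<partial>lborel) =
      (\<integral>\<^sup>+t. (\<integral>\<^sup>+s. indicator (S s) t \<partial>lborel) \<partial>lborel)"
    unfolding S_def by (rule lborel_pair.Fubini') measurable
  also have "\<dots> = (\<integral>\<^sup>+t\<in>{0..<1}. F t \<partial>lborel)"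
  proof (rule nn_integral_cong)
    fix t :: real
    show "(\<integral>\<^sup>+s. indicator (S s) t \<partial>lborel) = ennreal (F t) * indicator {0..<1} t"
    proof (cases "t \<in> {0..<1}")
      case True
      have "(\<integral>\<^sup>+s. indicator (S s) t \<partial>lborel) = (\<integral>\<^sup>+s. indicator {s. 0 \<le> s \<and> s < F t} s \<partial>lborel)"
        using True by (intro nn_integral_cong) (auto simp: S_def indicator_def)
      thus ?thesis using True F0[OF True] by (simp add: ennreal_eq_nn_integral_levels)
    next
      case False
      have "(\<integral>\<^sup>+s. indicator (S s) t \<partial>lborel) = (\<integral>\<^sup>+s. 0 \<partial>(lborel::real measure))"
        using False by (intro nn_integral_cong) (auto simp: S_def)
      thus ?thesis using False by simp
    qed
  qed
  finally show ?thesis .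
qed

section \<open>Circle means and disc automorphisms\<close>

lemma has_integral_circle_mean:
  fixes h :: "complex \<Rightarrow> complex"
  assumes h: "h holomorphic_on ball 0 R" and R: "R > 1"
  shows "((\<lambda>t. h (cis t)) has_integral (2 * pi * h 0)) {0..2 * pi}"
proof -
  have sub: "cball (0::complex) 1 \<subseteq> ball 0 R" using R by auto
  have "((\<lambda>u. h u / (u - 0)) has_contour_integral 2 * of_real pi * \<i> * h 0) (circlepath 0 1)"
    using h sub by (intro Cauchy_integral_circlepath_simple holomorphic_on_subset[OF h]) auto
  hence "((\<lambda>t. h (0 + of_real 1 * cis t) / (0 + of_real 1 * cis t - 0) * of_real 1 * \<i> * cis t)
     has_integral (2 * of_real pi * \<i> * h 0)) {0..2 * pi}"
    unfolding circlepath_def by (subst (asm) has_contour_integral_part_circlepath_iff) auto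
  hence "((\<lambda>t. \<i> * h (cis t)) has_integral (\<i> * (2 * of_real pi * h 0))) {0..2 * pi}"
    by (simp add: field_simps)
  from has_integral_mult_right[OF this, of "-\<i>"] show ?thesis
    by (simp add: mult.assoc[symmetric])
qed

lemma mult_in_half_plane:
  assumes "norm b \<le> 1" "norm u < 1"
  shows "0 < Re (1 - b * (u::complex))"
proof -
  have "norm (b * u) < 1"
    using assms by (smt (verit) mult_le_one mult_left_le_one_le norm_ge_zero norm_mult)
  thus ?thesis using complex_Re_le_cmod[of "b * u"] by auto
qed

text \<open>
  The argument of \<open>w powr (-1/2)\<close> is at most \<open>\<pi>/4\<close> in modulus, so its real part controls its modulus.
\<close>

lemma inverse_sqrt_norm_le_Re:
  assumes "0 < Re w"
  shows "norm w powr (-1/2) \<le> sqrt 2 * Re (w powr (-1/2))"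
proof -
  have w: "w \<noteq> 0" using assms by auto
  have A: "\<bar>Arg w\<bar> < pi / 2" using assms Arg_Re_pos by blast
  have "Re (w powr (-1/2)) = norm w powr (-1/2) * cos (-1/2 * Arg w)"
    using w by (simp add: powr_def Re_exp powr_real_def Arg_eq_Im_Ln)
  moreover have "cos (pi/4) \<le> cos (1/2 * Arg w)"
    using A by (subst (2) cos_abs_real[symmetric]) (intro cos_monotone_0_pi_le, auto)
  hence "sqrt 2 / 2 \<le> cos (-1/2 * Arg w)" by (simp add: cos_45)
  hence "1 \<le> sqrt 2 * cos (-1/2 * Arg w)"
    using real_sqrt_mult_self[of 2] mult_left_mono[of "sqrt 2/2" "cos (-1/2 * Arg w)" "sqrt 2"] by simp
  hence "norm w powr (-1/2) * 1 \<le> norm w powr (-1/2) * (sqrt 2 * cos (-1/2 * Arg w))"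
    by (intro mult_left_mono) auto
  ultimately show ?thesis by (simp add: mult_ac)
qed

lemma holomorphic_inverse_sqrt:
  assumes b: "norm b \<le> 1" and r: "0 < r" "r < 1"
  shows "(\<lambda>z. (1 - b * (of_real r * z)) powr (-1/2)) holomorphic_on ball 0 (1 / r)"
proof (intro holomorphic_intros)
  fix z :: complex assume "z \<in> ball 0 (1 / r)"
  hence "norm (of_real r * z) < 1" using r by (simp add: norm_mult field_simps)
  from mult_in_half_plane[OF b this] show "1 - b * (of_real r * z) \<notin> \<real>\<^sub>\<le>\<^sub>0"
    by (auto simp: complex_nonpos_Reals_iff)
qed

text \<open>
  The value depends neither on \<open>b\<close> nor on \<open>r\<close>: the mean of a holomorphic function is its
  value at the centre, here \<open>1\<close>. This is where the uniformity over all disc automorphisms comes from.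
\<close>

lemma circle_mean_Re_inverse_sqrt:
  assumes b: "norm b \<le> 1" and r: "0 < r" "r < 1"
  shows "((\<lambda>t. Re ((1 - b * (of_real r * cis t)) powr (-1/2))) has_integral (2 * pi)) {0..2 * pi}"
  using has_integral_Re[OF has_integral_circle_mean[OF holomorphic_inverse_sqrt[OF assms]]] r by simp

lemma continuous_Re_inverse_sqrt:
  assumes b: "norm b \<le> 1" and r: "0 < r" "r < 1"
  shows "continuous_on A (\<lambda>t. Re ((1 - b * (of_real r * cis t)) powr (-1/2)))"
  by (rule continuous_on_compose2[OF continuous_on_Re[OF holomorphic_on_imp_continuous_on[OF
        holomorphic_inverse_sqrt[OF assms]]]])
     (use r in \<open>auto intro!: continuous_intros\<close>)

lemma disc_aut_in_disc:
  assumes a: "norm a < 1" and z: "norm z < 1"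
  shows "norm (disc_aut a z) < 1"
  using Moebius_function_norm_lt_1[of a z 0] assms
  by (simp add: disc_aut_def Moebius_function_def norm_divide norm_minus_commute)

text \<open>
  Expresses the distance of \<open>disc_aut a z\<close> to \<open>1\<close>, relative to that of \<open>a\<close>, as a quotient of two factors
  \<open>\<bar>1 - c z\<bar>\<close> with \<open>\<bar>c\<bar> \<le> 1\<close>, to which \<open>circle_mean_Re_inverse_sqrt\<close> applies.
\<close>

lemma one_minus_disc_aut:
  assumes a: "norm a < 1" and z: "norm z < 1"
  shows "norm (1 - disc_aut a z) * norm (1 - cnj a * z) = norm (1 - a) * norm (1 - (- (1 - cnj a) / (1 - a)) * z)"
proof -
  have "Re (1 - cnj a * z) > 0" using a z by (intro mult_in_half_plane) auto
  hence nz: "1 - cnj a * z \<noteq> 0" by (metis less_irrefl zero_complex.simps(1))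
  have na: "1 - a \<noteq> 0" using a by auto
  have "(1 - disc_aut a z) * (1 - cnj a * z) = (1 - a) * (1 - (- (1 - cnj a) / (1 - a)) * z)"
    using nz na by (simp add: disc_aut_def divide_simps) (simp add: algebra_simps)
  thus ?thesis by (metis norm_mult)
qed

section \<open>Estimates of the Cauchy kernel\<close>

text \<open>
  The exponents sum to \<open>-2\<close> and are chosen such that the integrand has an elementary
  antiderivative in \<open>x = 1 - t\<close>, namely \<open>(4/m) (x/(x+m)) powr (1/4)\<close>.
\<close>

lemma nn_integral_kernel:
  assumes m: "m > 0"
  shows "(\<integral>\<^sup>+t\<in>{0..<1}. ennreal ((1 - t) powr (-3/4) * (1 - t + m) powr (-5/4)) \<partial>lborel) \<le> ennreal (4 / m)"
proof -
  define f where "f t = (1 - t) powr (-3/4) * (1 - t + m) powr (-5/4)" for t :: real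
  define G where "G t = - (4 / m) * ((1 - t) / (1 - t + m)) powr (1/4)" for t :: real
  have I: "(f has_integral (G 1 - G 0)) {0..1}"
  proof (rule fundamental_theorem_of_calculus_interior)
    show "continuous_on {0..1} G" unfolding G_def using m
      by (intro continuous_on_mult continuous_on_powr' continuous_on_divide continuous_intros) auto
    fix t :: real assume t: "t \<in> {0<..<1}"
    define x where "x = 1 - t"
    have x: "x > 0" using t by (simp add: x_def)
    have "(G has_real_derivative f t) (at t)"
    proof -
      have "(G has_real_derivative (- (4/m) * ((1/4) * ((1 - t) / (1 - t + m)) powr (1/4 - 1) *
              ((- 1 * (1 - t + m) - (1 - t) * (- 1)) / ((1 - t + m) * (1 - t + m)))))) (at t)"
        unfolding G_def using t m
        by (auto intro!: derivative_eq_intros simp: add_pos_pos) (simp add: field_simps)?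
      also have "(- (4/m) * ((1/4) * ((1 - t) / (1 - t + m)) powr (1/4 - 1) *
              ((- 1 * (1 - t + m) - (1 - t) * (- 1)) / ((1 - t + m) * (1 - t + m))))) = 
              (x / (x + m)) powr (-3/4) / ((x + m) powr 2)"
        using m x by (simp add: x_def[symmetric] power2_eq_square)
      also have "\<dots> = x powr (-3/4) * ((x + m) powr (3/4) / (x + m) powr 2)"
        using m x by (simp add: powr_divide powr_minus field_simps)
      also have "(x + m) powr (3/4) / (x + m) powr 2 = (x + m) powr (-5/4)"
        by (simp add: powr_diff[symmetric])
      finally show ?thesis by (simp add: f_def x_def)
    qed
    thus "(G has_vector_derivative f t) (at t)"
      by (simp add: has_real_derivative_iff_has_vector_derivative)
  qed auto
  have "(\<integral>\<^sup>+t\<in>{0..<1}. f t \<partial>lborel) \<le> (\<integral>\<^sup>+t. ennreal (f t) * indicator {0..1} t \<partial>lborel)"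
    by (intro nn_integral_mono) (auto simp: indicator_def)
  also have "\<dots> = ennreal (G 1 - G 0)"
    by (intro nn_integral_has_integral_lebesgue'[OF _ I]) (simp add: f_def)
  also have "\<dots> \<le> ennreal (4 / m)"
    using m by (intro ennreal_leI) (auto simp: G_def field_simps powr_le1)
  finally show ?thesis unfolding f_def .
qed

lemma kernel_lower_bound:
  fixes z :: complex
  assumes z: "norm z < 1" and t: "0 \<le> t" "t < 1"
  shows "(1 - t) + norm (1 - z) \<le> 3 * norm (1 - of_real t * z)"
proof -
  have "norm (of_real t * z) \<le> t"
    using z t mult_left_le[of "norm z" t] by (simp add: norm_mult)
  hence A: "1 - t \<le> norm (1 - of_real t * z)"
    using norm_triangle_ineq2[of 1 "of_real t * z"] by simp
  have "norm (1 - z) = norm ((1 - of_real t * z) - of_real (1 - t) * z)" by (simp add: algebra_simps)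
  also have "\<dots> \<le> norm (1 - of_real t * z) + (1 - t)"
    using z t by (intro order.trans[OF norm_triangle_ineq4] add_left_mono) (simp only: norm_mult norm_of_real, simp add: mult_left_le)
  finally show ?thesis using A by simp
qed

text \<open>
  The ratio \<open>(x + m2) / (x + m1)\<close> is at most \<open>m2 / m1\<close>; spending its power \<open>1/4\<close> shifts a quarter of an
  exponent from \<open>x + m1\<close> to \<open>x + m2\<close> and leaves the integrable kernel of \<open>nn_integral_kernel\<close>. The exponent \<open>1/4\<close>
  is small enough for the square of the resulting bound to have finite circle means.
\<close>

lemma product_kernel_bound:
  assumes "0 < (x::real)" "0 < m1" "m1 \<le> m2"
  shows "1 / ((x + m1) * (x + m2)) \<le> (m2 / m1) powr (1/4) * (x powr (-3/4) * (x + m2) powr (-5/4))"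
proof -
  have "(x + m2) / (x + m1) \<le> m2 / m1" using assms by (simp add: field_simps)
  hence A: "((x + m2) / (x + m1)) powr (1/4) \<le> (m2 / m1) powr (1/4)"
    using assms by (intro powr_mono2) auto
  have B: "(x + m1) powr (-3/4) \<le> x powr (-3/4)"
    using assms by (intro powr_mono2') auto
  have "1 / ((x + m1) * (x + m2)) = (x + m1) powr (-1) * (x + m2) powr (-1)"
    using assms by (simp add: powr_minus field_simps)
  also have "(x + m1) powr (-1) = (x + m1) powr (-1/4) * (x + m1) powr (-3/4)"
    by (simp add: powr_add[symmetric])
  also have "(x + m2) powr (-1) = (x + m2) powr (1/4) * (x + m2) powr (-5/4)"
    by (simp add: powr_add[symmetric])
  also have "(x + m1) powr (-1/4) * (x + m1) powr (-3/4) * ((x + m2) powr (1/4) * (x + m2) powr (-5/4)) =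
     ((x + m2) / (x + m1)) powr (1/4) * ((x + m1) powr (-3/4) * (x + m2) powr (-5/4))"
    using assms by (simp add: powr_divide powr_minus field_simps)
  also have "\<dots> \<le> (m2 / m1) powr (1/4) * (x powr (-3/4) * (x + m2) powr (-5/4))"
    using A B by (intro mult_mono) auto
  finally show ?thesis .
qed

section \<open>Cauchy transforms of Carleson densities\<close>

lemma integrable_Carleson_density:
  fixes k :: "real \<Rightarrow> complex"
  assumes \<mu>: "Borel_measure_on_01 \<mu>" and k[measurable]: "k \<in> borel_measurable \<mu>"
    and car: "Carleson_bound K (density \<mu> (\<lambda>t. ennreal (norm (k t))))"
  shows "integrable \<mu> k" "(\<integral>\<^sup>+t. norm (k t) \<partial>\<mu>) \<le> ennreal K"
proof -
  have "emeasure (density \<mu> (\<lambda>t. ennreal (norm (k t)))) {0..<1} = (\<integral>\<^sup>+t. norm (k t) \<partial>\<mu>)"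
    using sets_Borel_measure_on_01[OF \<mu>, of "{0..<1}"] space_Borel_measure_on_01[OF \<mu>]
    by (subst emeasure_density) (auto intro!: nn_integral_cong simp: indicator_def)
  moreover have "emeasure (density \<mu> (\<lambda>t. ennreal (norm (k t)))) {0..<1} \<le> ennreal (K * (1 - 0))"
    using car unfolding Carleson_bound_def by (rule bspec) simp
  ultimately show *: "(\<integral>\<^sup>+t. norm (k t) \<partial>\<mu>) \<le> ennreal K" by simp
  show "integrable \<mu> k"
    by (intro integrableI_bounded k le_less_trans[OF *]) simp
qed

lemma integrable_Cauchy_transform:
  fixes k :: "real \<Rightarrow> complex"
  assumes \<mu>: "Borel_measure_on_01 \<mu>" and int: "integrable \<mu> k" and z: "norm z < 1"
  shows "integrable \<mu> (\<lambda>t. k t / (1 - of_real t * z))"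
proof (rule Bochner_Integration.integrable_bound)
  show "integrable \<mu> (\<lambda>t. norm (k t) * (1 / (1 - norm z)))"
    using int by (intro integrable_mult_left integrable_norm)
  have "(\<lambda>t::real. 1 - of_real t * z) \<in> borel_measurable \<mu>"
    by (intro measurable_Borel_measure_on_01[OF \<mu>]) measurable
  thus "(\<lambda>t. k t / (1 - of_real t * z)) \<in> borel_measurable \<mu>"
    using int by (intro borel_measurable_divide) auto
  show "AE t in \<mu>. norm (k t / (1 - of_real t * z)) \<le> norm (norm (k t) * (1 / (1 - norm z)))"
  proof (rule AE_I2)
    fix t assume "t \<in> space \<mu>"
    hence t: "0 \<le> t" "t < 1" using space_Borel_measure_on_01[OF \<mu>] by auto
    have "norm (of_real t * z) \<le> norm z" using t by (simp add: norm_mult mult_left_le_one_le)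
    hence A: "1 - norm z \<le> norm (1 - of_real t * z)"
      using norm_triangle_ineq2[of 1 "of_real t * z"] by simp
    have "norm (k t) / norm (1 - of_real t * z) \<le> norm (k t) / (1 - norm z)"
      using A z by (intro divide_left_mono mult_pos_pos) auto
    thus "norm (k t / (1 - of_real t * z)) \<le> norm (norm (k t) * (1 / (1 - norm z)))"
      using z by (simp add: norm_divide)
  qed
qed

text \<open>
  Expanding the kernel into a geometric series and integrating term by term exhibits the transform as
  a power series whose coefficients are the moments of \<open>k d\<mu>\<close>.
\<close>

lemma holomorphic_Cauchy_transform:
  fixes k :: "real \<Rightarrow> complex"
  assumes \<mu>: "Borel_measure_on_01 \<mu>" and int: "integrable \<mu> k"
  shows "(\<lambda>z. \<integral>t. k t / (1 - of_real t * z) \<partial>\<mu>) holomorphic_on ball 0 1"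
proof (rule power_series_holomorphic)
  fix z :: complex assume "z \<in> ball 0 1"
  hence z: "norm z < 1" by simp
  define f where "f n t = k t * of_real t ^ n * z ^ n" for n and t :: real
  have [measurable]: "(\<lambda>t::real. complex_of_real t ^ n) \<in> borel_measurable \<mu>" for n
    by (intro measurable_Borel_measure_on_01[OF \<mu>]) measurable
  have [measurable]: "k \<in> borel_measurable \<mu>" using int by auto
  have norm_f: "norm (f n t) \<le> norm (k t) * norm z ^ n" if "t \<in> space \<mu>" for n t
  proof -
    have t: "0 \<le> t" "t < 1" using that space_Borel_measure_on_01[OF \<mu>] by auto
    have "norm (k t) * t ^ n * norm z ^ n \<le> norm (k t) * 1 * norm z ^ n"
      using t by (intro mult_right_mono mult_left_mono) (auto intro: power_le_one)
    thus ?thesis using t by (simp add: f_def norm_mult norm_power)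
  qed
  have pow_int: "integrable \<mu> (\<lambda>t. k t * of_real t ^ n)" for n
  proof (rule Bochner_Integration.integrable_bound[OF int])
    show "AE t in \<mu>. norm (k t * of_real t ^ n) \<le> norm (k t)"
      using space_Borel_measure_on_01[OF \<mu>]
      by (intro AE_I2) (auto simp: norm_mult norm_power intro!: mult_left_le power_le_one)
  qed measurable
  hence f_int: "integrable \<mu> (f n)" for n
    unfolding f_def by (intro integrable_mult_left)
  have geo: "summable (\<lambda>n. C * norm z ^ n)" for C :: real
    by (rule summable_mult) (simp add: summable_geometric z)
  have "(\<lambda>n. \<integral>t. f n t \<partial>\<mu>) sums (\<integral>t. (\<Sum>n. f n t) \<partial>\<mu>)"
  proof (rule sums_integral[OF f_int])
    show "AE t in \<mu>. summable (\<lambda>n. norm (f n t))"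
    proof (rule AE_I2)
      fix t assume t: "t \<in> space \<mu>"
      show "summable (\<lambda>n. norm (f n t))"
        by (rule summable_comparison_test'[where N = 0, OF geo]) (use norm_f[OF t] in simp)
    qed
    have "(\<integral>t. norm (f n t) \<partial>\<mu>) \<le> (\<integral>t. norm (k t) \<partial>\<mu>) * norm z ^ n" for n
    proof -
      have "(\<integral>t. norm (f n t) \<partial>\<mu>) \<le> (\<integral>t. norm (k t) * norm z ^ n \<partial>\<mu>)"
        using norm_f f_int int by (intro integral_mono) auto
      thus ?thesis by simp
    qed
    thus "summable (\<lambda>n. \<integral>t. norm (f n t) \<partial>\<mu>)"
      by (intro summable_comparison_test'[where N = 0, OF geo]) simp
  qed
  also have "(\<lambda>n. \<integral>t. f n t \<partial>\<mu>) = (\<lambda>n. (\<integral>t. k t * of_real t ^ n \<partial>\<mu>) * (z - 0) ^ n)"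
    by (simp add: f_def)
  also have "(\<integral>t. (\<Sum>n. f n t) \<partial>\<mu>) = (\<integral>t. k t / (1 - of_real t * z) \<partial>\<mu>)"
  proof (rule Bochner_Integration.integral_cong)
    fix t assume "t \<in> space \<mu>"
    hence t: "0 \<le> t" "t < 1" using space_Borel_measure_on_01[OF \<mu>] by auto
    have "norm (of_real t * z) < 1" using t z mult_left_le_one_le[of "norm z" t]
      by (simp add: norm_mult)
    hence "(\<lambda>n. k t * (of_real t * z) ^ n) sums (k t * (1 / (1 - of_real t * z)))"
      by (intro sums_mult geometric_sums)
    thus "(\<Sum>n. f n t) = k t / (1 - of_real t * z)"
      by (simp add: f_def sums_iff power_mult_distrib mult_ac)
  qed simp
  finally show "(\<lambda>n. (\<integral>t. k t * of_real t ^ n \<partial>\<mu>) * (z - 0) ^ n) sums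
    (\<integral>t. k t / (1 - of_real t * z) \<partial>\<mu>)" .
qed

text \<open>
  The difference of the two kernels carries the factor \<open>z - a\<close>, of size at most \<open>2 \<bar>1-a\<bar>\<close>, and the product
  of the two kernels is bounded by an increasing function of \<open>t\<close>; the integral of the latter against
  the Carleson measure \<open>\<bar>k\<bar> d\<mu>\<close> is, up to a factor, at most \<open>K / \<bar>1-a\<bar>\<close> times the ratio of the distances to \<open>1\<close> to the
  power \<open>1/4\<close>, so that the size of \<open>z - a\<close> cancels.
\<close>

lemma Cauchy_transform_diff_ordered:
  fixes k :: "real \<Rightarrow> complex"
  assumes \<mu>: "Borel_measure_on_01 \<mu>" and k[measurable]: "k \<in> borel_measurable \<mu>"
    and car: "Carleson_bound K (density \<mu> (\<lambda>t. ennreal (norm (k t))))" and K: "K \<ge> 0"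
    and z: "norm z < 1" and a: "norm a < 1" and le: "norm (1 - z) \<le> norm (1 - a)"
  shows "norm ((\<integral>t. k t / (1 - of_real t * z) \<partial>\<mu>) - (\<integral>t. k t / (1 - of_real t * a) \<partial>\<mu>))
    \<le> 72 * K * (norm (1 - a) / norm (1 - z)) powr (1/4)"
proof -
  define m1 where "m1 = norm (1 - z)"
  define m2 where "m2 = norm (1 - a)"
  define \<kappa> where "\<kappa> = density \<mu> (\<lambda>t. ennreal (norm (k t)))"
  define F where "F t = (1 - t) powr (-3/4) * (1 - t + m2) powr (-5/4)" for t :: real
  have m: "0 < m1" "0 < m2" "m1 \<le> m2" using z a le by (auto simp: m1_def m2_def)
  have int: "integrable \<mu> k" by (rule integrable_Carleson_density[OF \<mu> k car])
  note intz = integrable_Cauchy_transform[OF \<mu> int z]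
  note inta = integrable_Cauchy_transform[OF \<mu> int a]
  \<comment> \<open>The factor 18 is 2 from the bound on \<open>z - a\<close> and 3 from each of the two kernels.\<close>
  define C where "C = 18 * m2 * (m2 / m1) powr (1/4)"
  have C: "C \<ge> 0" using m by (simp add: C_def)
  have F[measurable]: "F \<in> borel_measurable borel" unfolding F_def by measurable
  have F\<mu>[measurable]: "F \<in> borel_measurable \<mu>" by (rule measurable_Borel_measure_on_01[OF \<mu> F])
  have bound: "norm (k t / (1 - of_real t * z) - k t / (1 - of_real t * a)) \<le> C * (norm (k t) * F t)"
    if "t \<in> space \<mu>" for t
  proof -
    have t: "0 \<le> t" "t < 1" using that space_Borel_measure_on_01[OF \<mu>] by auto
    define D1 where "D1 = norm (1 - of_real t * z)"
    define D2 where "D2 = norm (1 - of_real t * a)"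
    have D: "(1 - t) + m1 \<le> 3 * D1" "(1 - t) + m2 \<le> 3 * D2"
      using kernel_lower_bound[OF z t] kernel_lower_bound[OF a t] by (auto simp: D1_def D2_def m1_def m2_def)
    hence Dpos: "D1 > 0" "D2 > 0" using m t by auto
    have nz: "1 - of_real t * z \<noteq> 0" "1 - of_real t * a \<noteq> 0" using Dpos by (auto simp: D1_def D2_def)
    have "k t / (1 - of_real t * z) - k t / (1 - of_real t * a) =
       k t * (of_real t * (z - a)) / ((1 - of_real t * z) * (1 - of_real t * a))"
      using nz by (simp add: divide_simps) (simp add: algebra_simps)
    hence "norm (k t / (1 - of_real t * z) - k t / (1 - of_real t * a)) =
       norm (k t) * (t * norm (z - a)) / (D1 * D2)"
      using t by (simp add: norm_mult norm_divide D1_def D2_def)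
    also have "\<dots> \<le> norm (k t) * (1 * (2 * m2)) / (((1 - t + m1) / 3) * ((1 - t + m2) / 3))"
    proof (intro frac_le mult_left_mono mult_mono)
      have "norm (z - a) \<le> norm (1 - a) + norm (1 - z)"
        using norm_triangle_ineq4[of "1 - a" "1 - z"] by simp
      thus "norm (z - a) \<le> 2 * m2" using m unfolding m1_def m2_def by linarith
    qed (use D t m in auto)
    also have "\<dots> = 18 * m2 * norm (k t) * (1 / ((1 - t + m1) * (1 - t + m2)))"
      using t m by (simp add: field_simps)
    also have "\<dots> \<le> 18 * m2 * norm (k t) * ((m2 / m1) powr (1/4) * F t)"
      unfolding F_def using t m by (intro mult_left_mono product_kernel_bound) auto
    finally show ?thesis by (simp add: C_def mult_ac)
  qed
  have "(\<integral>\<^sup>+t. F t \<partial>\<kappa>) \<le> ennreal K * (\<integral>\<^sup>+t\<in>{0..<1}. F t \<partial>lborel)"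
  proof (rule nn_integral_mono_Carleson[OF _ _ K F])
    show "Borel_measure_on_01 \<kappa>" using \<mu> by (simp add: \<kappa>_def Borel_measure_on_01_def)
    show "Carleson_bound K \<kappa>" using car by (simp add: \<kappa>_def)
    show "mono_on {0..<1} F" unfolding F_def using m
      by (intro mono_onI mult_mono powr_mono2') auto
  qed (auto simp: F_def)
  also have "\<dots> \<le> ennreal K * ennreal (4 / m2)"
    unfolding F_def using m by (intro mult_left_mono nn_integral_kernel) auto
  finally have \<kappa>F: "(\<integral>\<^sup>+t. F t \<partial>\<kappa>) \<le> ennreal K * ennreal (4 / m2)" .
  have "ennreal (norm ((\<integral>t. k t / (1 - of_real t * z) \<partial>\<mu>) - (\<integral>t. k t / (1 - of_real t * a) \<partial>\<mu>))) =
     ennreal (norm (\<integral>t. k t / (1 - of_real t * z) - k t / (1 - of_real t * a) \<partial>\<mu>))"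
    by (simp add: Bochner_Integration.integral_diff[OF intz inta])
  also have "\<dots> \<le> (\<integral>\<^sup>+t. norm (k t / (1 - of_real t * z) - k t / (1 - of_real t * a)) \<partial>\<mu>)"
    using intz inta by (intro integral_norm_bound_ennreal) auto
  also have "\<dots> \<le> (\<integral>\<^sup>+t. ennreal C * (ennreal (norm (k t)) * ennreal (F t)) \<partial>\<mu>)"
  proof (rule nn_integral_mono)
    fix t assume "t \<in> space \<mu>"
    hence "ennreal (norm (k t / (1 - of_real t * z) - k t / (1 - of_real t * a))) \<le> ennreal (C * (norm (k t) * F t))"
      by (intro ennreal_leI bound)
    also have "\<dots> = ennreal C * (ennreal (norm (k t)) * ennreal (F t))"
      using C by (simp add: ennreal_mult F_def)
    finally show "ennreal (norm (k t / (1 - of_real t * z) - k t / (1 - of_real t * a))) \<le> ennreal C * (ennreal (norm (k t)) * ennreal (F t))" .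
  qed
  also have "\<dots> = ennreal C * (\<integral>\<^sup>+t. ennreal (norm (k t)) * ennreal (F t) \<partial>\<mu>)"
    by (rule nn_integral_cmult) measurable
  also have "(\<integral>\<^sup>+t. ennreal (norm (k t)) * ennreal (F t) \<partial>\<mu>) = (\<integral>\<^sup>+t. F t \<partial>\<kappa>)"
    unfolding \<kappa>_def by (rule nn_integral_density[symmetric]) measurable
  also have "ennreal C * \<dots> \<le> ennreal C * (ennreal K * ennreal (4 / m2))"
    by (intro mult_left_mono \<kappa>F) simp
  also have "\<dots> = ennreal (C * (K * (4 / m2)))"
    using C K by (simp only: ennreal_mult')
  finally have "ennreal (norm ((\<integral>t. k t / (1 - of_real t * z) \<partial>\<mu>) - (\<integral>t. k t / (1 - of_real t * a) \<partial>\<mu>)))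
     \<le> ennreal (C * (K * (4 / m2)))" .
  hence "norm ((\<integral>t. k t / (1 - of_real t * z) \<partial>\<mu>) - (\<integral>t. k t / (1 - of_real t * a) \<partial>\<mu>)) \<le> C * (K * (4 / m2))"
    using C K m by (subst (asm) ennreal_le_iff) auto
  also have "C * (K * (4 / m2)) = 72 * K * (norm (1 - a) / norm (1 - z)) powr (1/4)"
    using m by (simp add: C_def m1_def[symmetric] m2_def[symmetric])
  finally show ?thesis .
qed

text \<open>
  The sum of both powers covers the two possible orders of \<open>\<bar>1-z\<bar>\<close> and \<open>\<bar>1-a\<bar>\<close> at once.
\<close>

lemma Cauchy_transform_diff:
  fixes k :: "real \<Rightarrow> complex"
  assumes "Borel_measure_on_01 \<mu>" "k \<in> borel_measurable \<mu>"
    "Carleson_bound K (density \<mu> (\<lambda>t. ennreal (norm (k t))))" "K \<ge> 0"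
    and z: "norm z < 1" and a: "norm a < 1"
  shows "(norm ((\<integral>t. k t / (1 - of_real t * z) \<partial>\<mu>) - (\<integral>t. k t / (1 - of_real t * a) \<partial>\<mu>)))\<^sup>2
    \<le> (72 * K)\<^sup>2 * ((norm (1 - z) / norm (1 - a)) powr (1/2) + (norm (1 - a) / norm (1 - z)) powr (1/2))"
    (is "(norm (?G z - ?G a))\<^sup>2 \<le> _")
proof -
  have sq: "(72 * K * x powr (1/4))\<^sup>2 = (72 * K)\<^sup>2 * x powr (1/2)" for x :: real
    by (simp add: power2_eq_square powr_add[symmetric] mult_ac)
  show ?thesis
  proof (cases "norm (1 - z) \<le> norm (1 - a)")
    case True
    have "(norm (?G z - ?G a))\<^sup>2 \<le> (72 * K * (norm (1 - a) / norm (1 - z)) powr (1/4))\<^sup>2"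
      by (intro power_mono Cauchy_transform_diff_ordered assms True) auto
    also have "\<dots> \<le> (72 * K)\<^sup>2 * ((norm (1 - z) / norm (1 - a)) powr (1/2) + (norm (1 - a) / norm (1 - z)) powr (1/2))"
      unfolding sq by (intro mult_left_mono) auto
    finally show ?thesis .
  next
    case False
    have "(norm (?G a - ?G z))\<^sup>2 \<le> (72 * K * (norm (1 - z) / norm (1 - a)) powr (1/4))\<^sup>2"
      using False by (intro power_mono Cauchy_transform_diff_ordered assms) auto
    also have "\<dots> \<le> (72 * K)\<^sup>2 * ((norm (1 - z) / norm (1 - a)) powr (1/2) + (norm (1 - a) / norm (1 - z)) powr (1/2))"
      unfolding sq by (intro mult_left_mono) auto
    finally show ?thesis by (simp add: norm_minus_commute)
  qed
qed

text \<open>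
  For \<open>z = disc_aut a u\<close> the quotients in \<open>Cauchy_transform_diff\<close> become quotients of \<open>n1 = \<bar>1 - cnj a u\<bar>\<close>
  and \<open>n2 = \<bar>1 - b u\<bar>\<close> with \<open>\<bar>b\<bar> = 1\<close>. The numerators are at most \<open>2\<close>, and the circle means of the
  denominators are uniformly bounded.
\<close>

theorem BMOA_enorm_Cauchy_transform:
  fixes k :: "real \<Rightarrow> complex"
  assumes \<mu>: "Borel_measure_on_01 \<mu>" and k: "k \<in> borel_measurable \<mu>"
    and car: "Carleson_bound K (density \<mu> (\<lambda>t. ennreal (norm (k t))))" and K: "K \<ge> 0"
    and G: "\<And>z. norm z < 1 \<Longrightarrow> G z = (\<integral>t. k t / (1 - of_real t * z) \<partial>\<mu>)"
  shows "BMOA_enorm G \<le> ennreal (145 * K)"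
proof -
  have H2: "H2_enorm (\<lambda>z. G (disc_aut a z) - G a) \<le> ennreal (144 * K)" if "a \<in> ball 0 1" for a
  proof -
    have a: "norm a < 1" using that by simp
    have na: "1 - a \<noteq> 0" using a by auto
    define b where "b = - (1 - cnj a) / (1 - a)"
    have b: "norm b = 1"
    proof -
      have "norm (cnj a - 1) = norm (1 - a)"
        by (metis complex_cnj_diff complex_cnj_one complex_mod_cnj norm_minus_commute)
      thus ?thesis using na by (simp add: b_def norm_divide)
    qed
    show ?thesis unfolding H2_enorm_def
    proof (rule SUP_least)
      fix r :: real assume "r \<in> {0<..<1}"
      hence r: "0 < r" "r < 1" by auto
      define A where "A = (72 * K)\<^sup>2"
      define P where "P c t = Re ((1 - c * (of_real r * cis t)) powr (-1/2))" for c t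
      \<comment> \<open>A majorant of the squared oscillation along the circle whose mean is explicitly known.\<close>
      define g where "g t = A * (2 * P (cnj a) t + 2 * P b t)" for t
      have P: "(P c has_integral 2 * pi) {0..2 * pi}" if "norm c \<le> 1" for c
        unfolding P_def by (rule circle_mean_Re_inverse_sqrt[OF that r])
      have Pnn: "norm (1 - c * (of_real r * cis t)) powr (-1/2) \<le> sqrt 2 * P c t" if "norm c \<le> 1" for c t
        unfolding P_def using r that by (intro inverse_sqrt_norm_le_Re mult_in_half_plane) (auto simp: norm_mult)
      have Pnn': "0 \<le> P c t" if "norm c \<le> 1" for c t
      proof -
        have "0 \<le> sqrt 2 * P c t" by (rule order_trans[OF powr_ge_zero Pnn[OF that]])
        thus ?thesis by (simp add: zero_le_mult_iff)
      qed
      have g: "(g has_integral (8 * pi * A)) {0..2 * pi}"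
      proof -
        have "(g has_integral (A * (2 * (2 * pi) + 2 * (2 * pi)))) {0..2 * pi}"
          unfolding g_def using a b by (intro has_integral_mult_right has_integral_add P) auto
        thus ?thesis by (simp add: mult_ac)
      qed
      have g0: "0 \<le> g t" for t
        unfolding g_def A_def using Pnn'[of "cnj a"] Pnn'[of b] a b by simp
      have le: "(norm (G (disc_aut a (of_real r * cis t)) - G a))\<^sup>2 \<le> g t" for t
      proof -
        define u where "u = of_real r * cis t"
        have u: "norm u < 1" using r by (simp add: u_def norm_mult)
        note w = disc_aut_in_disc[OF a u]
        define n1 where "n1 = norm (1 - cnj a * u)"
        define n2 where "n2 = norm (1 - b * u)"
        have Re: "Re (1 - cnj a * u) > 0" "Re (1 - b * u) > 0"
          using mult_in_half_plane[of "cnj a" u] mult_in_half_plane[of b u] a b u by simp_all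
        have n: "n1 > 0" "n2 > 0" 
          using Re complex_Re_le_cmod[of "1 - cnj a * u"] complex_Re_le_cmod[of "1 - b * u"]
          unfolding n1_def n2_def by linarith+
        have n2: "n1 \<le> 2" "n2 \<le> 2"
        proof -
          have "norm (c * u) \<le> 1" if "norm c \<le> 1" for c
            using that u by (simp add: norm_mult mult_le_one)
          hence *: "norm (1 - c * u) \<le> 2" if "norm c \<le> 1" for c
            using that order.trans[OF norm_triangle_ineq4[of 1 "c * u"]] by force
          show "n1 \<le> 2" "n2 \<le> 2" using *[of "cnj a"] *[of b] a b by (auto simp: n1_def n2_def)
        qed
        have na': "norm (1 - a) > 0" and nw: "norm (1 - disc_aut a u) > 0" using na w by auto
        have rel: "norm (1 - disc_aut a u) * n1 = norm (1 - a) * n2"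
          using one_minus_disc_aut[OF a u] by (simp add: n1_def n2_def b_def)
        hence q: "norm (1 - disc_aut a u) / norm (1 - a) = n2 / n1" "norm (1 - a) / norm (1 - disc_aut a u) = n1 / n2"
          using n na' nw by (simp_all add: field_simps)
        have half: "(x / y) powr (1/2) \<le> sqrt 2 * y powr (-1/2)" if "0 < x" "x \<le> 2" "0 < y" for x y :: real
        proof -
          have "(x / y) powr (1/2) = x powr (1/2) * y powr (-1/2)"
            using that by (simp add: powr_divide powr_minus field_simps)
          also have "\<dots> \<le> 2 powr (1/2) * y powr (-1/2)"
            using that by (intro mult_right_mono powr_mono2) auto
          finally show ?thesis by (simp add: powr_half_sqrt)
        qed
        have h: "sqrt 2 * n1 powr (-1/2) \<le> 2 * P (cnj a) t" "sqrt 2 * n2 powr (-1/2) \<le> 2 * P b t"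
        proof -
          have "sqrt 2 * n1 powr (-1/2) \<le> sqrt 2 * (sqrt 2 * P (cnj a) t)"
            unfolding n1_def u_def using a by (intro mult_left_mono Pnn) auto
          also have "\<dots> = 2 * P (cnj a) t" by simp
          finally show "sqrt 2 * n1 powr (-1/2) \<le> 2 * P (cnj a) t" .
          have "sqrt 2 * n2 powr (-1/2) \<le> sqrt 2 * (sqrt 2 * P b t)"
            unfolding n2_def u_def using b by (intro mult_left_mono Pnn) auto
          also have "\<dots> = 2 * P b t" by simp
          finally show "sqrt 2 * n2 powr (-1/2) \<le> 2 * P b t" .
        qed
        have "(norm (G (disc_aut a u) - G a))\<^sup>2 \<le> A * ((n2 / n1) powr (1/2) + (n1 / n2) powr (1/2))"
          using Cauchy_transform_diff[OF \<mu> k car K w a] unfolding q A_def G[OF w] G[OF a] .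
        also have "\<dots> \<le> A * (2 * P (cnj a) t + 2 * P b t)"
          using half[OF n(2) n2(2) n(1)] half[OF n(1) n2(1) n(2)] h
          by (intro mult_left_mono add_mono) (auto simp: A_def)
        finally show ?thesis by (simp add: g_def u_def)
      qed
      have gI: "set_integrable lborel {0..2 * pi} g"
      proof (rule borel_integrable_atLeastAtMost')
        have "continuous_on {0..2 * pi} (P c)" if "norm c \<le> 1" for c
          unfolding P_def by (rule continuous_Re_inverse_sqrt[OF that r])
        thus "continuous_on {0..2 * pi} g" unfolding g_def using a b by (intro continuous_intros) auto
      qed
      have "(LBINT t:{0..2 * pi}. (norm (G (disc_aut a (of_real r * cis t)) - G a))\<^sup>2) \<le> (LBINT t:{0..2 * pi}. g t)"
        unfolding set_lebesgue_integral_def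
        by (rule integral_mono') (use gI le g0 in \<open>auto simp: set_integrable_def indicator_def\<close>)
      also have "\<dots> = 8 * pi * A"
        using set_borel_integral_eq_integral(2)[OF gI] integral_unique[OF g] by simp
      finally have "1 / (2 * pi) * (LBINT t:{0..2 * pi}. (norm (G (disc_aut a (of_real r * cis t)) - G a))\<^sup>2) \<le> 1 / (2 * pi) * (8 * pi * A)"
        by (intro mult_left_mono) auto
      also have "\<dots> = (144 * K)\<^sup>2" by (simp add: A_def power2_eq_square)
      finally have "sqrt (1 / (2 * pi) * (LBINT t:{0..2 * pi}. (norm (G (disc_aut a (of_real r * cis t)) - G a))\<^sup>2)) \<le> 144 * K"
        using K by (intro real_le_lsqrt) auto
      thus "ennreal (sqrt (1 / (2 * pi) * (LBINT t:{0..2 * pi}. (norm (G (disc_aut a (of_real r * cis t)) - G a))\<^sup>2))) \<le> ennreal (144 * K)"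
        by (rule ennreal_leI)
    qed
  qed
  have "ennreal (norm (G 0)) \<le> (\<integral>\<^sup>+t. norm (k t) \<partial>\<mu>)"
    using integral_norm_bound_ennreal[OF integrable_Carleson_density(1)[OF \<mu> k car]] by (simp add: G)
  also have "\<dots> \<le> ennreal K" by (rule integrable_Carleson_density[OF \<mu> k car])
  finally have G0: "ennreal (norm (G 0)) \<le> ennreal K" .
  have "BMOA_enorm G \<le> ennreal K + ennreal (144 * K)"
    unfolding BMOA_enorm_def by (intro add_mono G0 SUP_least H2)
  also have "\<dots> = ennreal (145 * K)" using K by (simp flip: ennreal_plus)
  finally show ?thesis .
qed

section \<open>The sub-mean value property of powers of analytic functions\<close>

text \<open>
  The graph of \<open>x powr p\<close> lies above its tangent at \<open>y\<close>. Integrating this affine bound replaces an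
  appeal to Jensen's inequality.
\<close>

lemma powr_tangent_bound:
  fixes x y p :: real
  assumes p: "p > 1" and x: "0 \<le> x" and y: "0 \<le> y"
  shows "p * y powr (p - 1) * x \<le> x powr p + (p - 1) * y powr p"
proof -
  define q where "q = p / (p - 1)"
  have q: "q > 1" "1 / p + 1 / q = 1" using p by (auto simp: q_def field_simps)
  have "x * y powr (p - 1) \<le> x powr p / p + (y powr (p - 1)) powr q / q"
    using p q x by (intro Youngs_inequality) auto
  also have "(y powr (p - 1)) powr q = y powr p" using p by (simp add: powr_powr q_def)
  finally have "p * (x * y powr (p - 1)) \<le> p * (x powr p / p + y powr p / q)"
    using p by (intro mult_left_mono) auto
  also have "\<dots> = x powr p + (p - 1) * y powr p" using p by (simp add: q_def field_simps)
  finally show ?thesis by (simp add: mult_ac)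
qed

text \<open>
  Handles exponents of both signs; the Besov weight has exponent \<open>p - 2\<close>, which is negative for \<open>p < 2\<close>.
\<close>

lemma powr_comparable:
  fixes a b q :: real
  assumes "0 < a" "0 < b" "a \<le> 3 * b" "b \<le> 3 * a"
  shows "a powr q \<le> 3 powr \<bar>q\<bar> * b powr q"
proof (cases "q \<ge> 0")
  case True
  have "a powr q \<le> (3 * b) powr q" using assms True by (intro powr_mono2) auto
  thus ?thesis using assms True by (simp add: powr_mult)
next
  case False
  have "a powr q \<le> (b / 3) powr q" using assms False by (intro powr_mono2') auto
  also have "\<dots> = 3 powr (-q) * b powr q" using assms by (simp add: powr_divide powr_minus field_simps)
  finally show ?thesis using False by simp
qed

lemma circle_mean_powr:
  fixes h :: "complex \<Rightarrow> complex"
  assumes h: "h holomorphic_on ball 0 R" and R: "R > 1" and p: "p > 1"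
  shows "ennreal (2 * pi * norm (h 0) powr p) \<le>
    (\<integral>\<^sup>+t. ennreal (norm (h (cis t)) powr p) * indicator {0..2 * pi} t \<partial>lborel)"
proof -
  define y where "y = norm (h 0)"
  define x where "x t = norm (h (cis t))" for t
  have cis_in: "cis t \<in> ball 0 R" for t using R by simp
  have cx: "continuous_on {0..2 * pi} x" unfolding x_def
    using cis_in by (intro continuous_on_norm continuous_on_compose2[OF holomorphic_on_imp_continuous_on[OF h]] continuous_intros) auto
  hence cxp: "continuous_on {0..2 * pi} (\<lambda>t. x t powr p)"
    using p by (intro continuous_on_powr' continuous_intros) (auto simp: x_def)
  define I where "I = integral {0..2 * pi} (\<lambda>t. x t powr p)"
  have I: "((\<lambda>t. x t powr p) has_integral I) {0..2 * pi}"
    unfolding I_def using cxp by (intro integrable_integral integrable_continuous_interval)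
  define J where "J = integral {0..2 * pi} x"
  have J: "(x has_integral J) {0..2 * pi}"
    unfolding J_def using cx by (intro integrable_integral integrable_continuous_interval)
  have "norm (integral {0..2 * pi} (\<lambda>t. h (cis t))) \<le> J"
    unfolding J_def
    by (intro integral_norm_bound_integral has_integral_integrable[OF has_integral_circle_mean[OF h R]]
          has_integral_integrable[OF J]) (simp add: x_def)
  hence yJ: "2 * pi * y \<le> J"
    using integral_unique[OF has_integral_circle_mean[OF h R]] by (simp add: y_def norm_mult)
  have A: "p * y powr (p - 1) * J \<le> I + (2 * pi) * ((p - 1) * y powr p)"
  proof (rule has_integral_le)
    show "((\<lambda>t. p * y powr (p - 1) * x t) has_integral p * y powr (p - 1) * J) {0..2 * pi}"
      by (intro has_integral_mult_right J)
    show "((\<lambda>t. x t powr p + (p - 1) * y powr p) has_integral I + (2 * pi) * ((p - 1) * y powr p)) {0..2 * pi}"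
      using has_integral_const_real[of "(p - 1) * y powr p" 0 "2 * pi"]
      by (intro has_integral_add I) auto
    show "p * y powr (p - 1) * x t \<le> x t powr p + (p - 1) * y powr p" for t
      using p by (intro powr_tangent_bound) (auto simp: x_def y_def)
  qed
  have "y powr (p - 1) * y = y powr p"
    using powr_mult_base[of y "p - 1"] by (simp add: y_def mult_ac)
  hence "2 * pi * p * y powr p = p * y powr (p - 1) * (2 * pi * y)" by (simp add: mult_ac)
  also have "\<dots> \<le> p * y powr (p - 1) * J"
    using p yJ by (intro mult_left_mono) auto
  finally have "2 * pi * y powr p \<le> I" using A by (simp add: algebra_simps)
  hence "ennreal (2 * pi * y powr p) \<le> ennreal I" by (rule ennreal_leI)
  also have "\<dots> = (\<integral>\<^sup>+t. ennreal (x t powr p) * indicator {0..2 * pi} t \<partial>lborel)"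
    by (intro nn_integral_has_integral_lebesgue'[OF _ I, symmetric]) simp
  finally show ?thesis by (simp add: x_def y_def)
qed

text \<open>
  Averaging over all rotations about \<open>c\<close> leaves the area integral unchanged and, after exchanging the
  integrals, replaces the integrand at each point by a circle mean, to which \<open>circle_mean_powr\<close> applies.
\<close>

lemma area_mean_powr:
  fixes g :: "complex \<Rightarrow> complex"
  assumes g: "g holomorphic_on ball c r" and r: "r > 0" and p: "p > 1"
  shows "ennreal (norm (g c) powr p * (pi * r\<^sup>2)) \<le> (\<integral>\<^sup>+z\<in>ball c r. ennreal (norm (g z) powr p) \<partial>lborel)"
proof -
  define v where "v z = ennreal (indicator (ball c r) z *\<^sub>R (norm (g z) powr p))" for z
  have v_eq: "v z = ennreal (norm (g z) powr p) * indicator (ball c r) z" for z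
    by (simp add: v_def indicator_def)
  have cg: "continuous_on (ball c r) (\<lambda>z. norm (g z) powr p)"
    using p holomorphic_on_imp_continuous_on[OF g]
    by (intro continuous_on_powr' continuous_intros) auto
  have v[measurable]: "v \<in> borel_measurable borel"
    unfolding v_def by (intro measurable_compose[OF _ measurable_ennreal] borel_measurable_continuous_on_indicator cg) auto
  define u where "u z = v (c + z)" for z
  have u[measurable]: "u \<in> borel_measurable borel" unfolding u_def by measurable
  have [measurable]: "cis \<in> borel_measurable borel"
    by (intro borel_measurable_continuous_onI continuous_intros)
  define y where "y = norm (g c) powr p"
  have inner: "ennreal (2 * pi * y) * indicator (ball 0 r) z \<le> (\<integral>\<^sup>+t. u (cis t * z) * indicator {0..2 * pi} t \<partial>lborel)" for z
  proof (cases "z \<in> ball 0 r")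
    case True
    define R where "R = (if z = 0 then 2 else r / norm z)"
    have R: "R > 1" using True by (auto simp: R_def)
    have "(\<lambda>\<zeta>. g (c + \<zeta> * z)) holomorphic_on ball 0 R"
    proof (rule holomorphic_on_compose_gen[OF _ g, unfolded o_def])
      show "(\<lambda>\<zeta>. c + \<zeta> * z) ` ball 0 R \<subseteq> ball c r"
        using r by (auto simp: R_def dist_norm norm_mult field_simps split: if_splits)
    qed (intro holomorphic_intros)
    from circle_mean_powr[OF this R p]
    have "ennreal (2 * pi * y) \<le> (\<integral>\<^sup>+t. ennreal (norm (g (c + cis t * z)) powr p) * indicator {0..2 * pi} t \<partial>lborel)"
      by (simp add: y_def)
    also have "\<dots> = (\<integral>\<^sup>+t. u (cis t * z) * indicator {0..2 * pi} t \<partial>lborel)"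
      using True by (intro nn_integral_cong) (auto simp: u_def v_eq dist_norm norm_mult)
    finally show ?thesis using True by simp
  qed simp
  have "ennreal (2 * pi) * ennreal (y * (pi * r\<^sup>2)) = ennreal (2 * pi * y) * emeasure lborel (ball (0::complex) r)"
    using r by (simp add: emeasure_ball unit_ball_vol_2 y_def ennreal_mult'[symmetric] mult_ac)
  also have "\<dots> = (\<integral>\<^sup>+z. ennreal (2 * pi * y) * indicator (ball 0 r) (z::complex) \<partial>lborel)"
    by (rule nn_integral_cmult_indicator[symmetric]) simp
  also have "\<dots> \<le> (\<integral>\<^sup>+z. (\<integral>\<^sup>+t. u (cis t * z) * indicator {0..2 * pi} t \<partial>lborel) \<partial>lborel)"
    by (intro nn_integral_mono inner)
  also have "\<dots> = (\<integral>\<^sup>+t. (\<integral>\<^sup>+z. u (cis t * z) * indicator {0..2 * pi} t \<partial>lborel) \<partial>lborel)"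
    by (rule lborel_pair.Fubini') measurable
  also have "\<dots> = (\<integral>\<^sup>+t. (\<integral>\<^sup>+z. u z \<partial>lborel) * indicator {0..2 * pi} t \<partial>lborel)"
    by (intro nn_integral_cong) (simp add: nn_integral_multc nn_integral_lborel_rotate)
  also have "\<dots> = ennreal (2 * pi) * (\<integral>\<^sup>+z. u z \<partial>lborel)"
    by (subst nn_integral_cmult_indicator) (simp_all add: mult.commute)
  finally have "ennreal (y * (pi * r\<^sup>2)) \<le> (\<integral>\<^sup>+z. u z \<partial>lborel)"
    by (subst (asm) ennreal_mult_le_mult_iff) auto
  also have "\<dots> = (\<integral>\<^sup>+z. v z \<partial>lborel)"
    unfolding u_def by (rule nn_integral_lborel_translate) measurable
  finally show ?thesis by (simp add: v_eq y_def)
qed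

section \<open>Besov functions on the radius\<close>

lemma one_minus_norm_square_pos: "norm z < 1 \<Longrightarrow> 0 < 1 - (norm z)\<^sup>2"
  by (simp add: abs_square_less_1)

lemma Besov_density_measurable:
  assumes f: "f holomorphic_on ball 0 1" and p: "p > 1"
  shows "(\<lambda>z. ennreal ((1 - (norm z)\<^sup>2) powr q * norm (deriv f z) powr p) * indicator (ball 0 1) z) \<in> borel_measurable borel"
proof -
  have f': "continuous_on (ball 0 1) (deriv f)"
    by (intro holomorphic_on_imp_continuous_on holomorphic_deriv f) auto
  have "continuous_on (ball 0 1) (\<lambda>z. (1 - (norm z)\<^sup>2) powr q * norm (deriv f z) powr p)"
  proof (intro continuous_on_mult)
    show "continuous_on (ball 0 1) (\<lambda>z::complex. (1 - (norm z)\<^sup>2) powr q)"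
      by (intro continuous_on_powr continuous_intros) (fastforce dest: one_minus_norm_square_pos)
    show "continuous_on (ball 0 1) (\<lambda>z. norm (deriv f z) powr p)"
      using p f' by (intro continuous_on_powr' continuous_intros) auto
  qed
  hence "(\<lambda>z. ennreal (indicator (ball 0 1) z *\<^sub>R ((1 - (norm z)\<^sup>2) powr q * norm (deriv f z) powr p))) \<in> borel_measurable borel"
    by (intro measurable_compose[OF _ measurable_ennreal] borel_measurable_continuous_on_indicator) auto
  also have "(\<lambda>z. ennreal (indicator (ball 0 1) z *\<^sub>R ((1 - (norm z)\<^sup>2) powr q * norm (deriv f z) powr p))) = 
    (\<lambda>z. ennreal ((1 - (norm z)\<^sup>2) powr q * norm (deriv f z) powr p) * indicator (ball 0 1) z)"
    by (auto simp: indicator_def)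
  finally show ?thesis .
qed

lemma Besov_energy_lborel:
  assumes f: "f holomorphic_on ball 0 1" and p: "p > 1"
  shows "(\<integral>\<^sup>+z\<in>ball 0 1. ennreal ((1 - (norm z)\<^sup>2) powr (p - 2) * norm (deriv f z) powr p) \<partial>lborel) = ennreal pi * Besov_energy p f"
proof -
  note [measurable] = Besov_density_measurable[OF f p, of "p - 2"]
  have "Besov_energy p f = ennreal (1 / pi) * (\<integral>\<^sup>+z\<in>ball 0 1. ennreal ((1 - (norm z)\<^sup>2) powr (p - 2) * norm (deriv f z) powr p) \<partial>lborel)"
    unfolding Besov_energy_def area_measure_def
    by (subst nn_integral_density) (auto intro!: nn_integral_cmult)
  thus ?thesis by (simp only: mult.assoc[symmetric] ennreal_mult'[symmetric] pi_ge_zero) simp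
qed

text \<open>
  The window contains all \<open>s\<close> whose disc of radius \<open>(1-s)/2\<close> reaches a given point \<open>w\<close> with
  \<open>x = 1 - \<bar>w\<bar>\<^sup>2\<close>; on it \<open>1/(1-s)\<close> is at most \<open>3/x\<close>.
\<close>

lemma nn_integral_window:
  fixes x :: real
  assumes x: "0 < x"
  shows "(\<integral>\<^sup>+s. ennreal (3 / x) * indicator {1 - 2 * x..1 - x / 3} s \<partial>lborel) = ennreal 5"
proof -
  have "(\<integral>\<^sup>+s. ennreal (3 / x) * indicator {1 - 2 * x..1 - x / 3} s \<partial>lborel) = ennreal (3 / x) * ennreal (5 * x / 3)"
    using x by (subst nn_integral_cmult_indicator) (auto simp: algebra_simps)
  also have "\<dots> = ennreal (3 / x * (5 * x / 3))"
    using x by (intro ennreal_mult'[symmetric]) auto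
  finally show ?thesis using x by simp
qed

text \<open>
  The measure \<open>(1-s) powr (p-1) ds\<close> on the radius is a Carleson measure for the weighted Bergman space of
  the derivatives. Each value \<open>f' s\<close> is estimated by the area mean over the disc of radius \<open>(1-s)/2\<close>
  about \<open>s\<close>; on that disc \<open>1 - \<bar>w\<bar>\<^sup>2\<close> is comparable to \<open>1 - s\<close>, and by Tonelli's theorem each point \<open>w\<close> is
  counted with bounded total weight.
\<close>

lemma radial_Carleson_embedding:
  assumes f: "f holomorphic_on ball 0 1" and p: "p > 1"
  shows "(\<integral>\<^sup>+s\<in>{0..<1}. ennreal ((1 - s) powr (p - 1) * norm (deriv f (of_real s)) powr p) \<partial>lborel)
     \<le> ennreal (20 * 3 powr \<bar>p - 2\<bar>) * Besov_energy p f"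
proof -
  define M where "M = 3 powr \<bar>p - 2\<bar>"
  define V where "V w = ennreal ((1 - (norm w)\<^sup>2) powr 0 * norm (deriv f w) powr p) * indicator (ball 0 1) w" for w
  define W where "W w = ennreal ((1 - (norm w)\<^sup>2) powr (p - 2) * norm (deriv f w) powr p) * indicator (ball 0 1) w" for w
  define X where "X w = 1 - (norm w)\<^sup>2" for w :: complex
  have [measurable]: "V \<in> borel_measurable borel" unfolding V_def by (rule Besov_density_measurable[OF f p])
  have [measurable]: "W \<in> borel_measurable borel" unfolding W_def by (rule Besov_density_measurable[OF f p])
  have f': "deriv f holomorphic_on ball 0 1" by (intro holomorphic_deriv f) auto
  define Z where "Z s w = indicator {s. norm (w - of_real s) < (1 - s) / 2} s * (indicator {0..<1} s * (ennreal (4 / pi * (1 - s) powr (p - 3)) * V w))"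
    for s :: real and w :: complex
  \<comment> \<open>\<open>Z s w\<close> is the share of the point \<open>w\<close> in the area mean that bounds the integrand at \<open>s\<close>.\<close>
  have 1: "ennreal ((1 - s) powr (p - 1) * norm (deriv f (of_real s)) powr p) * indicator {0..<1} s \<le> (\<integral>\<^sup>+w. Z s w \<partial>lborel)" for s
  proof (cases "s \<in> {0..<1}")
    case True
    define r where "r = (1 - s) / 2"
    have r: "r > 0" using True by (simp add: r_def)
    have sub: "ball (of_real s) r \<subseteq> ball (0::complex) 1"
    proof
      fix w :: complex assume "w \<in> ball (of_real s) r"
      hence "norm (w - of_real s) < (1 - s) / 2" by (simp add: dist_norm norm_minus_commute r_def)
      moreover have "norm w \<le> norm (w - of_real s) + s"
        using norm_triangle_ineq[of "w - of_real s" "of_real s"] True by simp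
      ultimately have "norm w < (1 - s) / 2 + s" by linarith
      also have "\<dots> < 1" using True by (simp add: field_simps)
      finally show "w \<in> ball 0 1" by simp
    qed
    define c where "c = 4 / pi * (1 - s) powr (p - 3)"
    have c: "c \<ge> 0" by (simp add: c_def)
    have [measurable]: "ball (complex_of_real s) r \<in> sets borel" by simp
    have "(1 - s) powr (p - 1) = (1 - s) powr (p - 3) * (1 - s) powr 2"
      by (simp add: powr_add[symmetric])
    also have "(1 - s) powr 2 = (1 - s)\<^sup>2" using True by simp
    also have "(1 - s) powr (p - 3) * (1 - s)\<^sup>2 = c * (pi * r\<^sup>2)"
      by (simp add: c_def r_def power_divide)
    finally have "(1 - s) powr (p - 1) = c * (pi * r\<^sup>2)" .
    hence "ennreal ((1 - s) powr (p - 1) * norm (deriv f (of_real s)) powr p) = ennreal c * ennreal (norm (deriv f (of_real s)) powr p * (pi * r\<^sup>2))"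
      using c by (simp add: ennreal_mult'[symmetric] mult_ac)
    also have "\<dots> \<le> ennreal c * (\<integral>\<^sup>+w\<in>ball (of_real s) r. ennreal (norm (deriv f w) powr p) \<partial>lborel)"
      by (intro mult_left_mono area_mean_powr holomorphic_on_subset[OF f' sub] r p) auto
    also have "(\<integral>\<^sup>+w\<in>ball (of_real s) r. ennreal (norm (deriv f w) powr p) \<partial>lborel) =
        (\<integral>\<^sup>+w. V w * indicator (ball (of_real s) r) w \<partial>lborel)"
    proof (rule nn_integral_cong)
      fix w :: complex
      have "X w \<noteq> 0" if "w \<in> ball 0 1"
        using that one_minus_norm_square_pos[of w] by (simp add: X_def)
      thus "ennreal (norm (deriv f w) powr p) * indicator (ball (of_real s) r) w = V w * indicator (ball (of_real s) r) w"
        using sub by (auto simp: V_def X_def indicator_def)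
    qed
    also have "ennreal c * \<dots> = (\<integral>\<^sup>+w. ennreal c * (V w * indicator (ball (of_real s) r) w) \<partial>lborel)"
      by (rule nn_integral_cmult[symmetric]) measurable
    also have "\<dots> = (\<integral>\<^sup>+w. Z s w \<partial>lborel)"
      using True by (intro nn_integral_cong) (auto simp: Z_def c_def r_def dist_norm norm_minus_commute indicator_def)
    finally show ?thesis using True by simp
  qed simp
  have 2: "(\<integral>\<^sup>+s. Z s w \<partial>lborel) \<le> ennreal (20 * M / pi) * W w" for w
  proof (cases "norm w < 1")
    case True
    have x: "X w > 0" using one_minus_norm_square_pos[OF True] by (simp add: X_def)
    define D where "D = ennreal (4 * M / pi) * W w"
    have "Z s w \<le> D * (ennreal (3 / X w) * indicator {1 - 2 * X w..1 - X w / 3} s)" for s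
    proof (cases "s \<in> {0..<1} \<and> norm (w - of_real s) < (1 - s) / 2")
      case s: True
      have nw: "norm w \<le> norm (w - of_real s) + s" "s \<le> norm w + norm (w - of_real s)"
        using norm_triangle_ineq[of "w - of_real s" "of_real s"] norm_triangle_ineq4[of w "w - of_real s"] s by simp_all
      have b: "(1 - s) / 2 \<le> 1 - norm w" "1 - norm w \<le> 3/2 * (1 - s)" using nw s by (auto simp: field_simps)
      have X: "X w = (1 - norm w) * (1 + norm w)" by (simp add: X_def power2_eq_square algebra_simps)
      have "(1 - norm w) * 1 \<le> X w" "X w \<le> (1 - norm w) * 2"
        unfolding X using True by (intro mult_left_mono; simp)+
      hence cmp: "1 - s \<le> 2 * X w" "X w \<le> 3 * (1 - s)" using b by (auto simp: field_simps)
      have s1: "1 - s > 0" using s by simp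
      have "(1 - s) powr (p - 3) = (1 - s) powr (p - 2) * (1 / (1 - s))"
        using s1 powr_diff[of "1 - s" "p - 2" 1] by simp
      also have "\<dots> \<le> (M * X w powr (p - 2)) * (3 / X w)"
      proof (rule mult_mono)
        show "(1 - s) powr (p - 2) \<le> M * X w powr (p - 2)"
          unfolding M_def using s1 x cmp by (intro powr_comparable) auto
        show "1 / (1 - s) \<le> 3 / X w" using s1 x cmp by (simp add: field_simps)
      qed (use s1 in \<open>auto simp: M_def\<close>)
      finally have "4 / pi * (1 - s) powr (p - 3) \<le> 4 / pi * ((M * X w powr (p - 2)) * (3 / X w))"
        by (intro mult_left_mono) auto
      also have "\<dots> = 4 * M / pi * (X w powr (p - 2)) * (3 / X w)" by simp
      finally have "4 / pi * (1 - s) powr (p - 3) \<le> 4 * M / pi * (X w powr (p - 2)) * (3 / X w)" .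
      hence "(4 / pi * (1 - s) powr (p - 3)) * norm (deriv f w) powr p \<le> 4 * M / pi * (X w powr (p - 2)) * (3 / X w) * norm (deriv f w) powr p"
        by (intro mult_right_mono) auto
      hence "ennreal ((4 / pi * (1 - s) powr (p - 3)) * norm (deriv f w) powr p) \<le> ennreal (4 * M / pi * (X w powr (p - 2) * norm (deriv f w) powr p) * (3 / X w))"
        by (intro ennreal_leI) (simp add: mult_ac)
      moreover have "Z s w = ennreal ((4 / pi * (1 - s) powr (p - 3)) * norm (deriv f w) powr p)"
      proof -
        have "Z s w = ennreal (4 / pi * (1 - s) powr (p - 3)) * ennreal (norm (deriv f w) powr p)"
          using s True x by (simp add: Z_def V_def X_def)
        also have "\<dots> = ennreal ((4 / pi * (1 - s) powr (p - 3)) * norm (deriv f w) powr p)"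
          by (rule ennreal_mult'[symmetric]) simp
        finally show ?thesis .
      qed
      moreover have "D * (ennreal (3 / X w) * indicator {1 - 2 * X w..1 - X w / 3} s) =
         ennreal (4 * M / pi * (X w powr (p - 2) * norm (deriv f w) powr p) * (3 / X w))"
      proof -
        have "s \<in> {1 - 2 * X w..1 - X w / 3}" using cmp by auto
        hence "D * (ennreal (3 / X w) * indicator {1 - 2 * X w..1 - X w / 3} s) =
          ennreal (4 * M / pi) * W w * ennreal (3 / X w)"
          by (simp only: D_def indicator_simps mult_1_right)
        also have "W w = ennreal (X w powr (p - 2) * norm (deriv f w) powr p)"
          using True by (simp add: W_def X_def)
        also have "ennreal (4 * M / pi) * \<dots> * ennreal (3 / X w) = ennreal (4 * M / pi * (X w powr (p - 2) * norm (deriv f w) powr p) * (3 / X w))"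
          by (subst ennreal_mult'[symmetric], simp add: M_def, subst ennreal_mult'[symmetric], simp_all add: M_def)
        finally show ?thesis .
      qed
      ultimately show ?thesis by simp
    next
      case False
      thus ?thesis by (auto simp: Z_def indicator_def)
    qed
    hence "(\<integral>\<^sup>+s. Z s w \<partial>lborel) \<le> (\<integral>\<^sup>+s. D * (ennreal (3 / X w) * indicator {1 - 2 * X w..1 - X w / 3} s) \<partial>lborel)"
      by (intro nn_integral_mono)
    also have "\<dots> = D * ennreal 5"
      using x by (subst nn_integral_cmult) (auto simp: nn_integral_window simp del: ennreal_numeral)
    also have "\<dots> = (ennreal (4 * M / pi) * ennreal 5) * W w" by (simp only: D_def mult_ac)
    also have "ennreal (4 * M / pi) * ennreal 5 = ennreal (20 * M / pi)"
      by (subst ennreal_mult'[symmetric]) (auto simp: M_def)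
    finally show ?thesis .
  next
    case False
    hence "(\<integral>\<^sup>+s. Z s w \<partial>lborel) = (\<integral>\<^sup>+s. 0 \<partial>(lborel::real measure))"
      by (intro nn_integral_cong) (auto simp: Z_def V_def)
    thus ?thesis by simp
  qed
  have "(\<integral>\<^sup>+s\<in>{0..<1}. ennreal ((1 - s) powr (p - 1) * norm (deriv f (of_real s)) powr p) \<partial>lborel) \<le> (\<integral>\<^sup>+s. (\<integral>\<^sup>+w. Z s w \<partial>lborel) \<partial>lborel)"
    by (intro nn_integral_mono 1)
  also have "\<dots> = (\<integral>\<^sup>+w. (\<integral>\<^sup>+s. Z s w \<partial>lborel) \<partial>lborel)"
    unfolding Z_def by (rule lborel_pair.Fubini') measurable
  also have "\<dots> \<le> (\<integral>\<^sup>+w. ennreal (20 * M / pi) * W w \<partial>lborel)"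
    by (intro nn_integral_mono 2)
  also have "\<dots> = ennreal (20 * M / pi) * (\<integral>\<^sup>+w. W w \<partial>lborel)"
    by (rule nn_integral_cmult) measurable
  also have "(\<integral>\<^sup>+w. W w \<partial>lborel) = ennreal pi * Besov_energy p f"
    unfolding W_def by (rule Besov_energy_lborel[OF f p])
  also have "ennreal (20 * M / pi) * (ennreal pi * Besov_energy p f) = ennreal (20 * M) * Besov_energy p f"
    by (simp add: mult.assoc[symmetric] ennreal_mult'[symmetric] M_def)
  finally show ?thesis by (simp add: M_def)
qed

section \<open>Growth and normality of bounded sets in the Besov space\<close>

lemma Besov_seminorm_powr:
  assumes "p > 1"
  shows "Besov_seminorm p f powr p = enn2real (Besov_energy p f)"
  using assms by (simp add: Besov_seminorm_def powr_powr)

lemma Besov_energy_eq: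
  assumes "f \<in> Besov p"
  shows "Besov_energy p f = ennreal (enn2real (Besov_energy p f))"
  using assms by (auto simp: Besov_def)

lemma Besov_seminorm_nonneg: "0 \<le> Besov_seminorm p f"
  by (simp add: Besov_seminorm_def)

lemma Besov_norm_bounds:
  assumes p: "p > 1"
  shows "norm (f 0) \<le> Besov_norm p f" "Besov_seminorm p f \<le> Besov_norm p f"
proof -
  have "norm (f 0) = (norm (f 0) powr p) powr (1 / p)" using p by (simp add: powr_powr)
  also have "\<dots> \<le> Besov_norm p f" unfolding Besov_norm_def using p by (intro powr_mono2) auto
  finally show "norm (f 0) \<le> Besov_norm p f" .
  have "Besov_seminorm p f = (Besov_seminorm p f powr p) powr (1 / p)"
    using p Besov_seminorm_nonneg[of p f] by (simp add: powr_powr)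
  also have "\<dots> \<le> Besov_norm p f" unfolding Besov_norm_def using p by (intro powr_mono2) auto
  finally show "Besov_seminorm p f \<le> Besov_norm p f" .
qed

text \<open>
  Hoelder's inequality in the form of Young's inequality for the factors \<open>a\<close> and \<open>b\<close>, normalised such
  that the powers \<open>a powr p\<close> and \<open>b powr p'\<close> have integral at most \<open>1\<close>. The factor \<open>b\<close> carries the weight
  \<open>1/(1-s)\<close>, whose integral is the logarithm.
\<close>

lemma radial_growth_of_weighted_derivative:
  assumes f: "f holomorphic_on ball 0 1" and p: "p > 1" "1 / p + 1 / p' = 1" and N: "N > 0"
    and E: "(\<integral>\<^sup>+s\<in>{0..<1}. ennreal ((1 - s) powr (p - 1) * norm (deriv f (of_real s)) powr p) \<partial>lborel) \<le> ennreal (N powr p)"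
    and t: "0 \<le> t" "t < 1"
  shows "norm (f (of_real t) - f 0) \<le> N * ln (2 / (1 - t)) powr (1 / p')"
proof -
  have p': "p' = p / (p - 1)"
    using p by (cases "p' = 0") (auto simp: field_simps)
  have p'1: "p' > 1" using p by (simp add: p' field_simps)
  define l where "l = ln (2 / (1 - t))"
  have l: "l > 0" using t by (simp add: l_def)
  define \<phi> where "\<phi> s = norm (deriv f (of_real s))" for s :: real
  have in_disc: "complex_of_real s \<in> ball 0 1" if "s \<in> {0..t}" for s using that t by auto
  have cd: "continuous_on {0..t} (\<lambda>s. deriv f (of_real s))"
    using in_disc by (intro continuous_on_compose2[OF holomorphic_on_imp_continuous_on[OF holomorphic_deriv[OF f]]] continuous_intros) auto
  hence c\<phi>: "continuous_on {0..t} \<phi>" unfolding \<phi>_def by (intro continuous_intros)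
  define I where "I = integral {0..t} (\<lambda>s. (1 - s) powr (p - 1) * \<phi> s powr p)"
  have "continuous_on {0..t} (\<lambda>s. (1 - s) powr (p - 1) * \<phi> s powr p)"
    using p t by (intro continuous_on_mult continuous_on_powr' c\<phi> continuous_intros) (auto simp: \<phi>_def)
  hence I: "((\<lambda>s. (1 - s) powr (p - 1) * \<phi> s powr p) has_integral I) {0..t}"
    unfolding I_def by (intro integrable_integral integrable_continuous_interval)
  have "ennreal I = (\<integral>\<^sup>+s. ennreal ((1 - s) powr (p - 1) * \<phi> s powr p) * indicator {0..t} s \<partial>lborel)"
    by (intro nn_integral_has_integral_lebesgue'[OF _ I, symmetric]) simp
  also have "\<dots> \<le> (\<integral>\<^sup>+s\<in>{0..<1}. ennreal ((1 - s) powr (p - 1) * norm (deriv f (of_real s)) powr p) \<partial>lborel)"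
    using t by (intro nn_integral_mono) (auto simp: \<phi>_def indicator_def)
  also note E
  finally have IN: "I \<le> N powr p" by (simp add: ennreal_le_iff)
  have lnI: "((\<lambda>s. 1 / (1 - s)) has_integral (- ln (1 - t))) {0..t}"
  proof -
    have "((\<lambda>s. 1 / (1 - s)) has_integral (- ln (1 - t) - (- ln (1 - 0)))) {0..t}"
      using t by (intro fundamental_theorem_of_calculus)
        (auto intro!: derivative_eq_intros simp flip: has_real_derivative_iff_has_vector_derivative)
    thus ?thesis by simp
  qed
  define A where "A = N * l powr (1 / p')"
  have A: "A > 0" using N l by (simp add: A_def)
  have young: "\<phi> s \<le> A * (1 / (p * N powr p) * ((1 - s) powr (p - 1) * \<phi> s powr p) + 1 / (l * p') * (1 / (1 - s)))"
    if s: "s \<in> {0..t}" for s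
  proof -
    have s1: "1 - s > 0" using s t by auto
    define a where "a = (1 - s) powr (1 / p') * \<phi> s / N"
    define b where "b = ((1 - s) * l) powr (- (1 / p'))"
    have e: "1 / p' * p = p - 1" using p by (simp add: p' field_simps)
    have ap: "a powr p = (1 - s) powr (p - 1) * \<phi> s powr p / N powr p"
      unfolding a_def using N s1 e by (simp add: powr_divide powr_mult powr_powr \<phi>_def)
    have bp: "b powr p' = 1 / ((1 - s) * l)"
    proof -
      have "- (1 / p') * p' = - 1" using p'1 by simp
      thus ?thesis unfolding b_def powr_powr using s1 l by (simp only: powr_minus_divide) simp
    qed
    have "a * b \<le> a powr p / p + b powr p' / p'"
      using p p'1 N by (intro Youngs_inequality) (auto simp: a_def b_def \<phi>_def)
    also have "\<dots> = 1 / (p * N powr p) * ((1 - s) powr (p - 1) * \<phi> s powr p) + 1 / (l * p') * (1 / (1 - s))"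
      unfolding ap bp by (simp add: mult_ac)
    finally have "A * (a * b) \<le> A * (1 / (p * N powr p) * ((1 - s) powr (p - 1) * \<phi> s powr p) + 1 / (l * p') * (1 / (1 - s)))"
      using A by (intro mult_left_mono) auto
    moreover have "A * (a * b) = \<phi> s"
    proof -
      have "b = (1 - s) powr (- (1 / p')) * l powr (- (1 / p'))"
        unfolding b_def using s1 l by (simp add: powr_mult)
      thus ?thesis using s1 l N by (simp add: A_def a_def powr_minus field_simps)
    qed
    ultimately show ?thesis by simp
  qed
  have FT: "((\<lambda>s. deriv f (of_real s)) has_integral (f (of_real t) - f (of_real 0))) {0..t}"
  proof (rule fundamental_theorem_of_calculus[OF t(1)])
    fix s assume "s \<in> {0..t}"
    hence "(f has_field_derivative deriv f (of_real s)) (at (of_real s))"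
      using in_disc by (intro holomorphic_derivI[OF f]) auto
    thus "((\<lambda>x. f (of_real x)) has_vector_derivative deriv f (of_real s)) (at s within {0..t})"
      by (rule has_vector_derivative_real_field)
  qed
  have maj: "((\<lambda>s. A * (1 / (p * N powr p) * ((1 - s) powr (p - 1) * \<phi> s powr p) + 1 / (l * p') * (1 / (1 - s))))
      has_integral A * (1 / (p * N powr p) * I + 1 / (l * p') * (- ln (1 - t)))) {0..t}"
    by (intro has_integral_mult_right has_integral_add I lnI)
  have "norm (integral {0..t} (\<lambda>s. deriv f (of_real s))) \<le> 
      integral {0..t} (\<lambda>s. A * (1 / (p * N powr p) * ((1 - s) powr (p - 1) * \<phi> s powr p) + 1 / (l * p') * (1 / (1 - s))))"
  proof (rule integral_norm_bound_integral)
    show "(\<lambda>s. deriv f (of_real s)) integrable_on {0..t}" using FT by blast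
    show "(\<lambda>s. A * (1 / (p * N powr p) * ((1 - s) powr (p - 1) * \<phi> s powr p) + 1 / (l * p') * (1 / (1 - s)))) integrable_on {0..t}"
      by (rule has_integral_integrable[OF maj])
    show "norm (deriv f (of_real s)) \<le> A * (1 / (p * N powr p) * ((1 - s) powr (p - 1) * \<phi> s powr p) + 1 / (l * p') * (1 / (1 - s)))"
      if "s \<in> {0..t}" for s using young[OF that] by (simp add: \<phi>_def)
  qed
  also have "\<dots> = A * (1 / (p * N powr p) * I + 1 / (l * p') * (- ln (1 - t)))"
    by (rule integral_unique[OF maj])
  also have "\<dots> \<le> A * (1 / p + 1 / p')"
  proof (intro mult_left_mono add_mono)
    show "1 / (p * N powr p) * I \<le> 1 / p" using IN p N by (simp add: field_simps)
    have "l = ln 2 - ln (1 - t)" using t by (simp add: l_def ln_div)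
    hence "- ln (1 - t) \<le> l" by simp
    thus "1 / (l * p') * (- ln (1 - t)) \<le> 1 / p'" using l p'1 by (simp add: field_simps)
  qed (use A in auto)
  finally show ?thesis using integral_unique[OF FT] p by (simp add: A_def l_def)
qed

text \<open>
  Here \<open>\<bar>f 0\<bar>\<close> is absorbed using that the logarithm is at least \<open>ln 2\<close>.
\<close>

lemma Besov_radial_growth:
  assumes f: "f \<in> Besov p" and p: "p > 1" "1 / p + 1 / p' = 1" and t: "0 \<le> t" "t < 1"
  shows "norm (f (of_real t)) \<le> (1 / ln 2 powr (1 / p') + (20 * 3 powr \<bar>p - 2\<bar>) powr (1 / p)) * Besov_norm p f * ln (2 / (1 - t)) powr (1 / p')"
proof -
  have hol: "f holomorphic_on ball 0 1" using f by (simp add: Besov_def)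
  have "1 / p < 1" using p(1) by simp
  hence p'0: "1 / p' \<ge> 0" using p(2) by linarith
  define C where "C = 20 * 3 powr \<bar>p - 2\<bar>"
  define \<rho> where "\<rho> = Besov_seminorm p f"
  define l where "l = ln (2 / (1 - t)) powr (1 / p')"
  have C: "C \<ge> 0" by (simp add: C_def)
  have \<rho>: "\<rho> \<ge> 0" by (simp add: \<rho>_def Besov_seminorm_nonneg)
  \<comment> \<open>The summand \<open>e\<close> makes the normalising constant positive when the seminorm vanishes.\<close>
  have "norm (f (of_real t) - f 0) \<le> (C powr (1 / p) * \<rho> + e) * l" if e: "e > 0" for e
    unfolding l_def
  proof (rule radial_growth_of_weighted_derivative[OF hol p _ _ t])
    show "C powr (1 / p) * \<rho> + e > 0" using \<rho> e by (simp add: add_nonneg_pos)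
    have "(\<integral>\<^sup>+s\<in>{0..<1}. ennreal ((1 - s) powr (p - 1) * norm (deriv f (of_real s)) powr p) \<partial>lborel) \<le> ennreal C * Besov_energy p f"
      unfolding C_def by (rule radial_Carleson_embedding[OF hol p(1)])
    also have "\<dots> = ennreal (C * \<rho> powr p)"
      using C by (subst Besov_energy_eq[OF f]) (simp add: \<rho>_def Besov_seminorm_powr[OF p(1)] ennreal_mult')
    also have "C * \<rho> powr p = (C powr (1 / p) * \<rho>) powr p"
      using C \<rho> p by (simp add: powr_mult powr_powr)
    also have "ennreal \<dots> \<le> ennreal ((C powr (1 / p) * \<rho> + e) powr p)"
      using \<rho> e p by (intro ennreal_leI powr_mono2) auto
    finally show "(\<integral>\<^sup>+s\<in>{0..<1}. ennreal ((1 - s) powr (p - 1) * norm (deriv f (of_real s)) powr p) \<partial>lborel) \<le> ennreal ((C powr (1 / p) * \<rho> + e) powr p)" .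
  qed
  hence "norm (f (of_real t) - f 0) \<le> (C powr (1 / p) * \<rho>) * l + e" if e: "e > 0" for e
  proof -
    have "l \<ge> 0" by (simp add: l_def)
    have "norm (f (of_real t) - f 0) \<le> (C powr (1 / p) * \<rho> + e / (l + 1)) * l"
      using \<open>l \<ge> 0\<close> e \<open>\<And>e. e > 0 \<Longrightarrow> norm (f (of_real t) - f 0) \<le> (C powr (1 / p) * \<rho> + e) * l\<close> by simp
    also have "\<dots> \<le> (C powr (1 / p) * \<rho>) * l + e" using \<open>l \<ge> 0\<close> e by (simp add: field_simps)
    finally show ?thesis .
  qed
  hence A: "norm (f (of_real t) - f 0) \<le> (C powr (1 / p) * \<rho>) * l" by (rule field_le_epsilon)
  have "ln 2 powr (1 / p') \<le> l"
    unfolding l_def using t p'0 by (intro powr_mono2) (auto simp: ln_div)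
  hence B: "1 \<le> 1 / ln 2 powr (1 / p') * l" by (simp add: field_simps)
  have "norm (f (of_real t)) \<le> norm (f 0) + norm (f (of_real t) - f 0)"
    using norm_triangle_sub by blast
  also have "\<dots> \<le> Besov_norm p f * (1 / ln 2 powr (1 / p') * l) + (C powr (1 / p) * Besov_norm p f) * l"
  proof (rule add_mono)
    have "norm (f 0) * 1 \<le> Besov_norm p f * (1 / ln 2 powr (1 / p') * l)"
      using Besov_norm_bounds(1)[OF p(1), of f] B by (intro mult_mono) (auto simp: Besov_norm_def)
    thus "norm (f 0) \<le> Besov_norm p f * (1 / ln 2 powr (1 / p') * l)" by simp
    show "norm (f (of_real t) - f 0) \<le> (C powr (1 / p) * Besov_norm p f) * l"
      using Besov_norm_bounds(2)[OF p(1), of f] unfolding \<rho>_def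
      by (intro order.trans[OF A] mult_right_mono mult_left_mono) (auto simp: \<rho>_def l_def)
  qed
  also have "\<dots> = (1 / ln 2 powr (1 / p') + C powr (1 / p)) * Besov_norm p f * l"
    by (simp add: algebra_simps)
  finally show ?thesis by (simp add: C_def l_def)
qed

text \<open>
  On a compact subset of the disc the weight is bounded below, so the sub-mean value property bounds
  the derivative by the seminorm.
\<close>

lemma Besov_locally_bounded:
  assumes p: "p > 1" and R: "0 < R" "R < 1"
  shows "\<exists>C. \<forall>f\<in>Besov p. \<forall>z\<in>cball 0 R. norm (f z) \<le> C * Besov_norm p f"
proof -
  define r where "r = (1 - R) / 2"
  have r: "0 < r" "r < 1" using R by (auto simp: r_def)
  define m where "m = r powr \<bar>p - 2\<bar>"
  have m: "m > 0" using r by (simp add: m_def)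
  define D where "D = (1 / (m * r\<^sup>2)) powr (1 / p)"
  have "norm (f z) \<le> (1 + D) * Besov_norm p f" if f: "f \<in> Besov p" and z: "z \<in> cball 0 R" for f z
  proof -
    have hol: "f holomorphic_on ball 0 1" using f by (simp add: Besov_def)
    have hol': "deriv f holomorphic_on ball 0 1" by (intro holomorphic_deriv hol) auto
    have deriv_bound: "norm (deriv f \<zeta>) \<le> D * Besov_norm p f" if \<zeta>: "\<zeta> \<in> cball 0 R" for \<zeta>
    proof -
      have near: "norm w < 1 - r" if "w \<in> ball \<zeta> r" for w
      proof -
        have "norm w \<le> norm \<zeta> + dist \<zeta> w" using norm_triangle_ineq2[of w \<zeta>] by (simp add: dist_norm norm_minus_commute)
        also have "\<dots> < R + r" using that \<zeta> by auto
        finally show ?thesis by (simp add: r_def field_simps)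
      qed
      have sub: "ball \<zeta> r \<subseteq> ball 0 1" using near r by fastforce
      have wt: "m \<le> (1 - (norm w)\<^sup>2) powr (p - 2)" if "w \<in> ball \<zeta> r" for w
      proof -
        define x where "x = 1 - (norm w)\<^sup>2"
        have "(norm w)\<^sup>2 \<le> norm w * 1" unfolding power2_eq_square using near[OF that] r by (intro mult_left_mono) auto
        hence x: "r \<le> x" "x \<le> 1" using near[OF that] by (auto simp: x_def)
        show ?thesis
        proof (cases "p \<ge> 2")
          case True
          thus ?thesis using x r unfolding m_def x_def[symmetric] by (auto intro!: powr_mono2)
        next
          case False
          have "m \<le> 1" unfolding m_def using r by (intro powr_le1) auto
          also have "1 \<le> x powr (p - 2)"
          proof -
            have "1 powr (p - 2) \<le> x powr (p - 2)" using x r False by (intro powr_mono2') auto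
            thus ?thesis by simp
          qed
          finally show ?thesis by (simp add: x_def)
        qed
      qed
      have "ennreal m * ennreal (norm (deriv f \<zeta>) powr p * (pi * r\<^sup>2)) \<le>
          ennreal m * (\<integral>\<^sup>+w\<in>ball \<zeta> r. ennreal (norm (deriv f w) powr p) \<partial>lborel)"
        by (intro mult_left_mono area_mean_powr holomorphic_on_subset[OF hol' sub] r p) auto
      also have "\<dots> = (\<integral>\<^sup>+w. ennreal m * (ennreal (norm (deriv f w) powr p) * indicator (ball \<zeta> r) w) \<partial>lborel)"
      proof (rule nn_integral_cmult[symmetric])
        have [measurable]: "ball \<zeta> r \<in> sets borel" by simp
        note [measurable] = Besov_density_measurable[OF hol p, of 0]
        have "(\<lambda>w. ennreal ((1 - (norm w)\<^sup>2) powr 0 * norm (deriv f w) powr p) * indicator (ball 0 1) w * indicator (ball \<zeta> r) w) \<in> borel_measurable borel"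
          by measurable
        also have "(\<lambda>w. ennreal ((1 - (norm w)\<^sup>2) powr 0 * norm (deriv f w) powr p) * indicator (ball 0 1) w * indicator (ball \<zeta> r) w) =
          (\<lambda>w. ennreal (norm (deriv f w) powr p) * indicator (ball \<zeta> r) w)"
          using sub one_minus_norm_square_pos by (fastforce simp: indicator_def)
        finally show "(\<lambda>w. ennreal (norm (deriv f w) powr p) * indicator (ball \<zeta> r) w) \<in> borel_measurable lborel" by simp
      qed
      also have "\<dots> \<le> (\<integral>\<^sup>+w\<in>ball 0 1. ennreal ((1 - (norm w)\<^sup>2) powr (p - 2) * norm (deriv f w) powr p) \<partial>lborel)"
      proof (intro nn_integral_mono)
        fix w :: complex
        show "ennreal m * (ennreal (norm (deriv f w) powr p) * indicator (ball \<zeta> r) w) \<le>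
          ennreal ((1 - (norm w)\<^sup>2) powr (p - 2) * norm (deriv f w) powr p) * indicator (ball 0 1) w"
        proof (cases "w \<in> ball \<zeta> r")
          case True
          hence "m * norm (deriv f w) powr p \<le> (1 - (norm w)\<^sup>2) powr (p - 2) * norm (deriv f w) powr p"
            by (intro mult_right_mono wt) auto
          moreover have "w \<in> ball 0 1" using True sub by blast
          ultimately show ?thesis using True m by (simp only: indicator_simps mult_1_right) (simp add: ennreal_mult'[symmetric] ennreal_leI)
        qed simp
      qed
      also have "\<dots> = ennreal (pi * enn2real (Besov_energy p f))"
        unfolding Besov_energy_lborel[OF hol p] by (subst Besov_energy_eq[OF f]) (simp add: ennreal_mult')
      finally have "ennreal (m * (norm (deriv f \<zeta>) powr p * (pi * r\<^sup>2))) \<le> ennreal (pi * enn2real (Besov_energy p f))"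
        using m by (simp only: ennreal_mult' less_imp_le)
      hence "m * (norm (deriv f \<zeta>) powr p * (pi * r\<^sup>2)) \<le> pi * Besov_seminorm p f powr p"
        by (subst (asm) ennreal_le_iff) (auto simp: Besov_seminorm_powr[OF p])
      hence "norm (deriv f \<zeta>) powr p \<le> 1 / (m * r\<^sup>2) * Besov_seminorm p f powr p"
        using m r by (simp add: field_simps)
      hence "(norm (deriv f \<zeta>) powr p) powr (1 / p) \<le> (1 / (m * r\<^sup>2) * Besov_seminorm p f powr p) powr (1 / p)"
        using p by (intro powr_mono2) auto
      hence "norm (deriv f \<zeta>) \<le> D * Besov_seminorm p f"
        using p m Besov_seminorm_nonneg[of p f] by (simp only: powr_mult powr_powr) (simp add: D_def)
      also have "\<dots> \<le> D * Besov_norm p f"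
        using Besov_norm_bounds(2)[OF p] by (intro mult_left_mono) (auto simp: D_def)
      finally show ?thesis .
    qed
    have "norm (f z - f 0) \<le> D * Besov_norm p f * norm (z - 0)"
    proof (rule field_differentiable_bound[where S = "cball 0 R"])
      fix w :: complex assume w: "w \<in> cball 0 R"
      show "(f has_field_derivative deriv f w) (at w within cball 0 R)"
        using w R by (intro holomorphic_derivI[OF hol]) auto
      show "norm (deriv f w) \<le> D * Besov_norm p f" by (rule deriv_bound[OF w])
    qed (use z R in auto)
    also have "\<dots> \<le> D * Besov_norm p f"
      using z R by (intro mult_left_le) (auto simp: D_def Besov_norm_def)
    finally have "norm (f z - f 0) \<le> D * Besov_norm p f" .
    moreover have "norm (f z) \<le> norm (f 0) + norm (f z - f 0)" using norm_triangle_sub by blast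
    ultimately show ?thesis using Besov_norm_bounds(1)[OF p, of f] by (simp add: algebra_simps)
  qed
  thus ?thesis by blast
qed

lemma Besov_bounded_sequence_normal:
  assumes p: "p > 1" and F: "range F \<subseteq> Besov p" and B: "\<And>n. Besov_norm p (F n) \<le> B"
  obtains f r where "f holomorphic_on ball 0 1" "strict_mono (r :: nat \<Rightarrow> nat)"
    "\<And>x. x \<in> ball 0 1 \<Longrightarrow> (\<lambda>n. F (r n) x) \<longlonglongrightarrow> f x"
    "\<And>K. compact K \<Longrightarrow> K \<subseteq> ball 0 1 \<Longrightarrow> uniform_limit K (F \<circ> r) f sequentially"
proof (rule Montel[of "ball 0 1" "{f \<in> Besov p. Besov_norm p f \<le> B}" F])
  show "range F \<subseteq> {f \<in> Besov p. Besov_norm p f \<le> B}" using F B by auto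
  show "h holomorphic_on ball 0 1" if "h \<in> {f \<in> Besov p. Besov_norm p f \<le> B}" for h
    using that by (simp add: Besov_def)
  show "\<exists>M. \<forall>h\<in>{f \<in> Besov p. Besov_norm p f \<le> B}. \<forall>z\<in>K. norm (h z) \<le> M"
    if K: "compact K" "K \<subseteq> ball 0 1" for K
  proof -
    obtain R where R: "0 < R" "R < 1" "K \<subseteq> cball 0 R"
    proof (cases "K = {}")
      case True
      thus ?thesis using that[of "1/2"] by simp
    next
      case False
      obtain w where w: "w \<in> K" "\<And>z. z \<in> K \<Longrightarrow> norm z \<le> norm w"
        using continuous_attains_sup[OF K(1) False, of norm] by (auto intro: continuous_intros)
      show ?thesis
      proof (rule that[of "(1 + norm w) / 2"])
        show "0 < (1 + norm w) / 2" by (simp add: add_pos_nonneg)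
        have "norm w < 1" using w K by auto
        thus "(1 + norm w) / 2 < 1" "K \<subseteq> cball 0 ((1 + norm w) / 2)"
          using w(2) by (fastforce simp: field_simps)+
      qed
    qed
    obtain A where A: "\<And>h z. h \<in> Besov p \<Longrightarrow> z \<in> cball 0 R \<Longrightarrow> norm (h z) \<le> A * Besov_norm p h"
      using Besov_locally_bounded[OF p R(1,2)] by blast
    have "norm (h z) \<le> \<bar>A\<bar> * B" if h: "h \<in> Besov p" "Besov_norm p h \<le> B" and z: "z \<in> K" for h z
    proof -
      have "norm (h z) \<le> A * Besov_norm p h" using h z R by (intro A) auto
      also have "\<dots> \<le> \<bar>A\<bar> * B" using h by (intro mult_mono) (auto simp: Besov_norm_def)
      finally show ?thesis .
    qed
    thus ?thesis by blast
  qed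
qed (use that in auto)

section \<open>The operator between the Besov space and BMOA\<close>

text \<open>
  Controls the Carleson constant of \<open>\<bar>k\<bar> d\<mu>\<close> by treating \<open>[0,\<tau>)\<close>, where \<open>k\<close> is small relative to \<open>L\<close>, and
  \<open>[\<tau>,1)\<close>, where \<open>\<nu>\<close> has a small Carleson constant, separately. With \<open>\<tau> = 0\<close> it is plain domination.
\<close>

lemma Carleson_bound_split:
  fixes k :: "real \<Rightarrow> complex" and L :: "real \<Rightarrow> real"
  assumes \<mu>: "Borel_measure_on_01 \<mu>" and L: "L \<in> borel_measurable borel"
    and \<nu>: "\<nu> = density \<mu> (\<lambda>t. ennreal (L t))"
    and L0: "\<And>t. 0 \<le> L t"
    and nonneg: "0 \<le> \<epsilon>" "0 \<le> M" "0 \<le> C" "0 \<le> \<delta>"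
    and near: "\<And>s. 0 \<le> s \<Longrightarrow> s < \<tau> \<Longrightarrow> norm (k s) \<le> \<epsilon> * L s"
    and all: "\<And>s. 0 \<le> s \<Longrightarrow> s < 1 \<Longrightarrow> norm (k s) \<le> M * L s"
    and \<tau>: "0 \<le> \<tau>" "\<tau> < 1"
    and C: "Carleson_bound C \<nu>"
    and \<delta>: "\<And>t. \<tau> \<le> t \<Longrightarrow> t < 1 \<Longrightarrow> emeasure \<nu> {t..<1} \<le> ennreal (\<delta> * (1 - t))"
    and k[measurable]: "k \<in> borel_measurable \<mu>"
  shows "Carleson_bound (\<epsilon> * C + M * \<delta>) (density \<mu> (\<lambda>t. ennreal (norm (k t))))"
  unfolding Carleson_bound_def
proof
  fix t :: real assume t: "t \<in> {0..<1}"
  define t' where "t' = max t \<tau>"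
  have t': "t \<le> t'" "\<tau> \<le> t'" "t' < 1" "0 \<le> t'" using t \<tau> by (auto simp: t'_def)
  note [measurable] = measurable_Borel_measure_on_01[OF \<mu> L]
  have [measurable]: "{t..<1} \<in> sets \<mu>" "{t'..<1} \<in> sets \<mu>"
    using t t' by (auto intro!: sets_Borel_measure_on_01[OF \<mu>])
  have em: "emeasure \<nu> A = (\<integral>\<^sup>+s. ennreal (L s) * indicator A s \<partial>\<mu>)" if "A \<in> sets \<mu>" for A
    unfolding \<nu> using that by (rule emeasure_density[rotated]) measurable
  have "emeasure (density \<mu> (\<lambda>t. ennreal (norm (k t)))) {t..<1} = (\<integral>\<^sup>+s. ennreal (norm (k s)) * indicator {t..<1} s \<partial>\<mu>)"
    by (rule emeasure_density) measurable
  also have "\<dots> \<le> (\<integral>\<^sup>+s. ennreal \<epsilon> * (ennreal (L s) * indicator {t..<1} s) + ennreal M * (ennreal (L s) * indicator {t'..<1} s) \<partial>\<mu>)"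
  proof (rule nn_integral_mono)
    fix s assume "s \<in> space \<mu>"
    hence s: "0 \<le> s" "s < 1" using space_Borel_measure_on_01[OF \<mu>] by auto
    show "ennreal (norm (k s)) * indicator {t..<1} s \<le>
       ennreal \<epsilon> * (ennreal (L s) * indicator {t..<1} s) + ennreal M * (ennreal (L s) * indicator {t'..<1} s)"
    proof (cases "s < t")
      case False
      show ?thesis
      proof (cases "s < \<tau>")
        case True
        have "ennreal (norm (k s)) \<le> ennreal \<epsilon> * ennreal (L s)"
          using near[OF s(1) True] nonneg L0 by (simp add: ennreal_mult'[symmetric] ennreal_leI)
        thus ?thesis using False s by (intro add_increasing2) auto
      next
        case F: False
        have "ennreal (norm (k s)) \<le> ennreal M * ennreal (L s)"
          using all[OF s] nonneg L0 by (simp add: ennreal_mult'[symmetric] ennreal_leI)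
        thus ?thesis using False F s by (intro add_increasing) (auto simp: t'_def)
      qed
    qed simp
  qed
  also have "\<dots> = (\<integral>\<^sup>+s. ennreal \<epsilon> * (ennreal (L s) * indicator {t..<1} s) \<partial>\<mu>) + (\<integral>\<^sup>+s. ennreal M * (ennreal (L s) * indicator {t'..<1} s) \<partial>\<mu>)"
    by (rule nn_integral_add) measurable
  also have "\<dots> = ennreal \<epsilon> * emeasure \<nu> {t..<1} + ennreal M * emeasure \<nu> {t'..<1}"
    by (simp add: em nn_integral_cmult)
  also have "\<dots> \<le> ennreal \<epsilon> * ennreal (C * (1 - t)) + ennreal M * ennreal (\<delta> * (1 - t))"
  proof (intro add_mono mult_left_mono)
    show "emeasure \<nu> {t..<1} \<le> ennreal (C * (1 - t))" using C t unfolding Carleson_bound_def by blast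
    have "emeasure \<nu> {t'..<1} \<le> ennreal (\<delta> * (1 - t'))" by (rule \<delta>[OF t'(2,3)])
    also have "\<dots> \<le> ennreal (\<delta> * (1 - t))" using t' nonneg by (intro ennreal_leI mult_left_mono) auto
    finally show "emeasure \<nu> {t'..<1} \<le> ennreal (\<delta> * (1 - t))" .
  qed auto
  also have "\<dots> = ennreal (\<epsilon> * (C * (1 - t))) + ennreal (M * (\<delta> * (1 - t)))"
    using nonneg by (simp only: ennreal_mult')
  also have "\<dots> = ennreal (\<epsilon> * (C * (1 - t)) + M * (\<delta> * (1 - t)))"
    using nonneg t by (intro ennreal_plus[symmetric] mult_nonneg_nonneg) auto
  also have "\<dots> = ennreal ((\<epsilon> * C + M * \<delta>) * (1 - t))"
    by (simp add: algebra_simps)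
  finally show "emeasure (density \<mu> (\<lambda>t. ennreal (norm (k t)))) {t..<1} \<le> ennreal ((\<epsilon> * C + M * \<delta>) * (1 - t))" .
qed

lemma measurable_radial_trace:
  assumes \<mu>: "Borel_measure_on_01 \<mu>" and f: "f holomorphic_on ball 0 1"
  shows "(\<lambda>t::real. f (of_real t)) \<in> borel_measurable \<mu>"
proof -
  have "continuous_on {0..<1} (\<lambda>t::real. f (of_real t))"
    by (intro continuous_on_compose2[OF holomorphic_on_imp_continuous_on[OF f]] continuous_intros) auto
  hence "(\<lambda>t::real. f (of_real t)) \<in> borel_measurable (restrict_space borel {0..<1})"
    by (rule borel_measurable_continuous_on_restrict)
  thus ?thesis using \<mu> by (simp add: Borel_measure_on_01_def cong: measurable_cong_sets)
qed

lemma I_op_BMOA: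
  assumes \<mu>: "Borel_measure_on_01 \<mu>" and f: "f holomorphic_on ball 0 1" and K: "K \<ge> 0"
    and car: "Carleson_bound K (density \<mu> (\<lambda>t. ennreal (norm (f (of_real t)))))"
  shows "I_op_defined \<mu> f" "I_op \<mu> f \<in> BMOA" "BMOA_norm (I_op \<mu> f) \<le> 145 * K"
proof -
  note k = measurable_radial_trace[OF \<mu> f]
  note int = integrable_Carleson_density(1)[OF \<mu> k car]
  have hol: "I_op \<mu> f holomorphic_on ball 0 1"
    unfolding I_op_def by (rule holomorphic_Cauchy_transform[OF \<mu> int])
  thus "I_op_defined \<mu> f"
    unfolding I_op_defined_def using integrable_Cauchy_transform[OF \<mu> int] by auto
  have le: "BMOA_enorm (I_op \<mu> f) \<le> ennreal (145 * K)"
    by (rule BMOA_enorm_Cauchy_transform[OF \<mu> k car K]) (simp add: I_op_def)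
  also have "\<dots> < \<infinity>" by simp
  finally show "I_op \<mu> f \<in> BMOA" using hol by (simp add: BMOA_def)
  show "BMOA_norm (I_op \<mu> f) \<le> 145 * K"
    unfolding BMOA_norm_def using enn2real_mono[OF le] K by simp
qed

theorem theorem3p4:
  fixes p p' :: real and \<mu> \<nu> :: "real measure"
  assumes p: "1 < p" and p': "1 / p + 1 / p' = 1"
    and \<mu>: "Borel_measure_on_01 \<mu>"
    and \<nu>: "\<nu> = density \<mu> (\<lambda>t. ennreal (ln (2 / (1 - t)) powr (1 / p')))"
  shows "(Carleson \<nu> \<longrightarrow> I_op_bounded \<mu> p) \<and>
         (vanishing_Carleson \<nu> \<longrightarrow> I_op_compact \<mu> p)"
proof -
  define L where "L t = ln (2 / (1 - t)) powr (1 / p')" for t :: real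
  define D where "D = 1 / ln 2 powr (1 / p') + (20 * 3 powr \<bar>p - 2\<bar>) powr (1 / p)"
  have D: "D \<ge> 0" by (simp add: D_def)
  have L[measurable]: "L \<in> borel_measurable borel" unfolding L_def by measurable
  have L0: "0 \<le> L t" for t by (simp add: L_def)
  have \<nu>L: "\<nu> = density \<mu> (\<lambda>t. ennreal (L t))" by (simp add: \<nu> L_def)
  have growth: "norm (f (of_real t)) \<le> D * Besov_norm p f * L t" if "f \<in> Besov p" "0 \<le> t" "t < 1" for f t
    unfolding D_def L_def by (rule Besov_radial_growth[OF that(1) p p' that(2,3)])
  have norm0: "Besov_norm p f \<ge> 0" for f by (simp add: Besov_norm_def)
  have bound: "I_op_defined \<mu> f \<and> I_op \<mu> f \<in> BMOA \<and> BMOA_norm (I_op \<mu> f) \<le> 145 * (M * C)"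
    if f: "f holomorphic_on ball 0 1" and M: "M \<ge> 0" "\<And>t. 0 \<le> t \<Longrightarrow> t < 1 \<Longrightarrow> norm (f (of_real t)) \<le> M * L t"
      and C: "C > 0" "Carleson_bound C \<nu>" for f M C
  proof -
    have "Carleson_bound (0 * C + M * C) (density \<mu> (\<lambda>t. ennreal (norm (f (of_real t)))))"
      by (rule Carleson_bound_split[OF \<mu> L \<nu>L L0, where \<tau> = 0])
         (use M C in \<open>auto simp: Carleson_bound_def intro: measurable_radial_trace[OF \<mu> f]\<close>)
    hence "Carleson_bound (M * C) (density \<mu> (\<lambda>t. ennreal (norm (f (of_real t)))))" by simp
    from I_op_BMOA[OF \<mu> f _ this] M C show ?thesis by simp
  qed
  have Besov_bound: "I_op_defined \<mu> f \<and> I_op \<mu> f \<in> BMOA \<and> BMOA_norm (I_op \<mu> f) \<le> 145 * (D * Besov_norm p f * C)"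
    if "f \<in> Besov p" "C > 0" "Carleson_bound C \<nu>" for f C
    using that growth[OF that(1)] D norm0[of f] by (intro bound) (auto simp: Besov_def)
  have "I_op_bounded \<mu> p" if car: "Carleson \<nu>"
  proof -
    obtain C where C: "C > 0" "Carleson_bound C \<nu>"
      using car unfolding Carleson_def Carleson_bound_def by blast
    have "BMOA_norm (I_op \<mu> f) \<le> (145 * D * C) * Besov_norm p f" if "f \<in> Besov p" for f
      using Besov_bound[OF that C] by (simp add: mult_ac)
    thus ?thesis unfolding I_op_bounded_def using Besov_bound[OF _ C] by blast
  qed
  moreover have "I_op_compact \<mu> p" if van: "vanishing_Carleson \<nu>"
  proof -
    obtain C where C: "C > 0" "Carleson_bound C \<nu>"
      using van unfolding vanishing_Carleson_def Carleson_def Carleson_bound_def by blast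
    have \<nu>01: "Borel_measure_on_01 \<nu>"
      using van by (simp add: vanishing_Carleson_def Carleson_def)
    interpret \<nu>: finite_measure \<nu> by (rule finite_measure_Carleson_bound[OF \<nu>01 C(2)])
    have seq: "\<exists>g\<in>BMOA. \<exists>r :: nat \<Rightarrow> nat. strict_mono r \<and>
           (\<lambda>k. BMOA_norm (\<lambda>z. I_op \<mu> (F (r k)) z - g z)) \<longlonglongrightarrow> 0"
      if F: "range F \<subseteq> Besov p" and bdd: "bdd_above (range (\<lambda>n. Besov_norm p (F n)))" for F
    proof -
      obtain B0 where B0: "\<And>n. Besov_norm p (F n) \<le> B0"
        using bdd by (auto simp: bdd_above_def)
      have B0': "B0 \<ge> 0" using B0[of 0] norm0[of "F 0"] by linarith
      obtain f r where f: "f holomorphic_on ball 0 1" and r: "strict_mono r"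
        and lim: "\<And>x. x \<in> ball 0 1 \<Longrightarrow> (\<lambda>n. F (r n) x) \<longlonglongrightarrow> f x"
        and unif: "\<And>K. compact K \<Longrightarrow> K \<subseteq> ball 0 1 \<Longrightarrow> uniform_limit K (F \<circ> r) f sequentially"
        using Besov_bounded_sequence_normal[OF p F B0] by blast
      define M where "M = D * B0"
      have M: "M \<ge> 0" using D B0' by (simp add: M_def)
      have FM: "norm (F n (of_real t)) \<le> M * L t" if "0 \<le> t" "t < 1" for n t
      proof -
        have "norm (F n (of_real t)) \<le> D * Besov_norm p (F n) * L t" using F that by (intro growth) auto
        also have "\<dots> \<le> M * L t" unfolding M_def using D B0 L0 by (intro mult_right_mono mult_left_mono) auto
        finally show ?thesis .
      qed
      have fM: "norm (f (of_real t)) \<le> M * L t" if "0 \<le> t" "t < 1" for t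
        using that by (intro Lim_bounded[OF tendsto_norm[OF lim]] allI impI FM) auto
      have F_hol: "F n holomorphic_on ball 0 1" for n using F by (auto simp: Besov_def)
      have F_def: "I_op_defined \<mu> (F n)" for n using bound[OF F_hol M FM C] by simp
      have f_def: "I_op_defined \<mu> f" and fB: "I_op \<mu> f \<in> BMOA" using bound[OF f M fM C] by auto
      have "\<exists>N. \<forall>n\<ge>N. BMOA_norm (\<lambda>z. I_op \<mu> (F (r n)) z - I_op \<mu> f z) \<le> 145 * e" if e: "e > 0" for e
      proof -
        \<comment> \<open>\<open>\<delta>\<close> and \<open>\<epsilon>\<close> are chosen such that the constant of \<open>Carleson_bound_split\<close> is at most \<open>e\<close>.\<close>
        define \<delta> where "\<delta> = e / (2 * (2 * M + 1))"
        define \<epsilon> where "\<epsilon> = e / (2 * C)"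
        have \<delta>: "\<delta> > 0" and \<epsilon>: "\<epsilon> > 0" using e M C by (auto simp: \<delta>_def \<epsilon>_def)
        have sum_le: "\<epsilon> * C + (2 * M) * \<delta> \<le> e"
        proof -
          have "(2 * M) * \<delta> \<le> (2 * M + 1) * \<delta>" using \<delta> by (simp add: algebra_simps)
          also have "\<dots> = e / 2" using M by (simp add: \<delta>_def field_simps)
          finally show ?thesis using C by (simp add: \<epsilon>_def)
        qed
        have "\<forall>\<^sub>F t in at_left 1. measure \<nu> {t..<1} / (1 - t) < \<delta>"
          using van \<delta> unfolding vanishing_Carleson_def by (intro order_tendstoD) auto
        then obtain b where b: "b < 1" "\<And>t. b < t \<Longrightarrow> t < 1 \<Longrightarrow> measure \<nu> {t..<1} / (1 - t) < \<delta>"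
          unfolding eventually_at_left_field by auto
        define \<tau> where "\<tau> = max 0 ((b + 1) / 2)"
        have \<tau>: "0 \<le> \<tau>" "\<tau> < 1" "b < \<tau>"
        proof -
          show "0 \<le> \<tau>" "\<tau> < 1" using b(1) by (auto simp: \<tau>_def)
          have "b < (b + 1) / 2" using b(1) by simp
          also have "\<dots> \<le> \<tau>" by (simp add: \<tau>_def)
          finally show "b < \<tau>" .
        qed
        have tail: "emeasure \<nu> {t..<1} \<le> ennreal (\<delta> * (1 - t))" if "\<tau> \<le> t" "t < 1" for t
        proof -
          have "measure \<nu> {t..<1} \<le> \<delta> * (1 - t)"
            using b(2)[of t] that \<tau> by (simp add: field_simps)
          thus ?thesis by (simp add: \<nu>.emeasure_eq_measure ennreal_leI)
        qed
        have L_lower: "ln 2 powr (1 / p') \<le> L t" if "0 \<le> t" "t < 1" for t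
        proof -
          have "1 / p < 1" using p by simp
          hence "1 / p' \<ge> 0" using p' by linarith
          thus ?thesis unfolding L_def using that by (intro powr_mono2) (auto simp: ln_div)
        qed
        define c where "c = ln 2 powr (1 / p')"
        have c: "c > 0" by (simp add: c_def)
        have "compact ((of_real :: real \<Rightarrow> complex) ` {0..\<tau>})"
          by (intro compact_continuous_image continuous_intros) auto
        moreover have "(of_real :: real \<Rightarrow> complex) ` {0..\<tau>} \<subseteq> ball 0 1" using \<tau> by auto
        ultimately have "uniform_limit (of_real ` {0..\<tau>}) (F \<circ> r) f sequentially" by (rule unif)
        from uniform_limitD[OF this, of "\<epsilon> * c"] \<epsilon> c
        obtain N where N: "\<And>n x. n \<ge> N \<Longrightarrow> x \<in> of_real ` {0..\<tau>} \<Longrightarrow> dist ((F \<circ> r) n x) (f x) < \<epsilon> * c"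
          unfolding eventually_sequentially by auto
        have "BMOA_norm (\<lambda>z. I_op \<mu> (F (r n)) z - I_op \<mu> f z) \<le> 145 * e" if n: "n \<ge> N" for n
        proof -
          define k where "k t = F (r n) (of_real t) - f (of_real t)" for t :: real
          have k: "k \<in> borel_measurable \<mu>" unfolding k_def
            by (intro borel_measurable_diff measurable_radial_trace[OF \<mu>] F_hol f)
          define K where "K = \<epsilon> * C + (2 * M) * \<delta>"
          have K: "K \<ge> 0" using \<epsilon> C M \<delta> by (simp add: K_def)
          have "Carleson_bound K (density \<mu> (\<lambda>t. ennreal (norm (k t))))"
            unfolding K_def
          proof (rule Carleson_bound_split[OF \<mu> L \<nu>L L0 _ _ _ _ _ _ \<tau>(1,2) C(2) tail k])
            fix s :: real assume s: "0 \<le> s" "s < \<tau>"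
            have "norm (k s) \<le> \<epsilon> * c"
              using N[OF n, of "of_real s"] s by (simp add: k_def dist_norm)
            also have "\<dots> \<le> \<epsilon> * L s" using L_lower[of s] s \<tau> \<epsilon> by (intro mult_left_mono) (auto simp: c_def)
            finally show "norm (k s) \<le> \<epsilon> * L s" .
          next
            fix s :: real assume s: "0 \<le> s" "s < 1"
            have "norm (k s) \<le> norm (F (r n) (of_real s)) + norm (f (of_real s))"
              unfolding k_def by (rule norm_triangle_ineq4)
            thus "norm (k s) \<le> 2 * M * L s" using FM[OF s, of "r n"] fM[OF s] by simp
          qed (use \<epsilon> M C \<delta> in auto)
          hence "BMOA_enorm (\<lambda>z. I_op \<mu> (F (r n)) z - I_op \<mu> f z) \<le> ennreal (145 * K)"
          proof (rule BMOA_enorm_Cauchy_transform[OF \<mu> k _ K])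
            fix z :: complex assume "norm z < 1"
            thus "I_op \<mu> (F (r n)) z - I_op \<mu> f z = (\<integral>t. k t / (1 - of_real t * z) \<partial>\<mu>)"
              using F_def[of "r n"] f_def unfolding I_op_def I_op_defined_def k_def
              by (simp add: diff_divide_distrib Bochner_Integration.integral_diff)
          qed
          from enn2real_mono[OF this] K
          have "BMOA_norm (\<lambda>z. I_op \<mu> (F (r n)) z - I_op \<mu> f z) \<le> 145 * K" by (simp add: BMOA_norm_def)
          thus ?thesis using sum_le by (simp add: K_def)
        qed
        thus ?thesis by blast
      qed note small = this
      have "(\<lambda>n. BMOA_norm (\<lambda>z. I_op \<mu> (F (r n)) z - I_op \<mu> f z)) \<longlonglongrightarrow> 0"
      proof (rule LIMSEQ_I)
        fix e :: real assume e: "e > 0"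
        obtain N where N: "\<And>n. n \<ge> N \<Longrightarrow> BMOA_norm (\<lambda>z. I_op \<mu> (F (r n)) z - I_op \<mu> f z) \<le> 145 * (e / 290)"
          using small[of "e / 290"] e by auto
        have "BMOA_norm h \<ge> 0" for h by (simp add: BMOA_norm_def)
        hence "norm (BMOA_norm (\<lambda>z. I_op \<mu> (F (r n)) z - I_op \<mu> f z) - 0) < e" if "n \<ge> N" for n
          using N[OF that] e by simp
        thus "\<exists>N. \<forall>n\<ge>N. norm (BMOA_norm (\<lambda>z. I_op \<mu> (F (r n)) z - I_op \<mu> f z) - 0) < e" by blast
      qed
      with fB r show ?thesis by blast
    qed
    show ?thesis unfolding I_op_compact_def using Besov_bound[OF _ C] seq by blast
  qed
  ultimately show ?thesis by blast
qed

end
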